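(* Let $k\ge 2$ and let $\mathcal{H}$ be a finite $k$-uniform hypergraph satisfying all of the following: (i) $\mathcal{H}$ has a vertex $z$ of degree $2$; (ii) $\delta(\mathcal{H} \setminus \{z\}) \geq 3$ and $d_{\mathcal H}(u) \geq 4$ for every $u \in V(\mathcal{H}) \setminus \{z\}$; (iii) $\mathcal{H} \setminus \{z\}$ has a fast winning strategy; (iv) for every two edges $e, e' \in E(\mathcal{H})$, every monomorphism $\phi : V(\mathcal{H} \setminus \{e, e'\}) \to V(\mathcal{H})$ is the identity; (v) $e \cap r \neq \emptyset$ and $e \cap g \neq \emptyset$ for every edge $e \in E(\mathcal{H})$, where $r$ and $g$ are the two edges of $\mathcal{H}$ incident with $z$; (vi) $|V(\mathcal{H}) \setminus (r \cup g)| < k-1$. Then the strong game $\mathcal{R}^{(k)}(\mathcal{H}, \aleph_0)$ is a draw.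
   Context: The strong game $\mathcal{R}^{(k)}(\mathcal{H}, \aleph_0)$: FP (first player) and SP (second player) alternately claim unclaimed edges of the countably infinite complete $k$-uniform hypergraph $K^k_{\mathbb{N}}$, one per move, FP first; the first player whose claimed edges contain a copy of $\mathcal{H}$ (a subhypergraph isomorphic to $\mathcal{H}$) wins; if neither player has a strategy ensuring his win in finitely many moves, the game is a draw. $d_{\mathcal H}(x)$ is the number of edges of $\mathcal H$ containing $x$, and $\delta$ is the minimum degree. $\mathcal{H}\setminus\{z\}$ for a vertex $z$ is the hypergraph obtained by deleting $z$ and all edges containing it. For a set $S$ of edges, $\mathcal{H}\setminus S$ is the hypergraph with edge set $E(\mathcal H)\setminus S$, and $V(\mathcal{H}\setminus S)$ denotes the union of its edges. A monomorphism $\phi: V(\mathcal{F}')\to V(\mathcal{F})$ (for $\mathcal F'\subseteq \mathcal F$) is an injective map such that $\phi(x)=\{\phi(a): a\in x\}$ is an edge of $\mathcal F$ for every edge $x$ of $\mathcal F'$; "$\phi$ is the identity" means $\phi(a)=a$ for all $a$ in its domain. A $k$-graph $\mathcal{F}$ has a fast winning strategy if, in the game where two players alternately claim unclaimed edges of $K^k_{\mathbb N}$, a player can ensure that his claimed edges contain a copy of $\mathcal{F}$ after $|E(\mathcal{F})|$ of his moves (disregarding whether the opponent builds a copy first). *)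

theory Defs
  imports Main
begin

definition k_uniform :: "nat \<Rightarrow> 'a set \<Rightarrow> 'a set set \<Rightarrow> bool" where
  "k_uniform k V E \<longleftrightarrow> finite V \<and> (\<forall>e\<in>E. e \<subseteq> V \<and> card e = k)"

definition degree :: "'a set set \<Rightarrow> 'a \<Rightarrow> nat" where
  "degree E x = card {e \<in> E. x \<in> e}"

definition del_vertex_V :: "'a set \<Rightarrow> 'a \<Rightarrow> 'a set" where
  "del_vertex_V V z = V - {z}"

definition del_vertex_E :: "'a set set \<Rightarrow> 'a \<Rightarrow> 'a set set" where
  "del_vertex_E E z = {e \<in> E. z \<notin> e}"

definition min_degree_ge :: "'a set \<Rightarrow> 'a set set \<Rightarrow> nat \<Rightarrow> bool" where
  "min_degree_ge V E d \<longleftrightarrow> (\<forall>u\<in>V. degree E u \<ge> d)"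

(* monomorphism phi : V(F') -> V(F) for F' with edge set E' (vertex set = union of E') *)
definition monomorphism :: "'a set set \<Rightarrow> 'a set set \<Rightarrow> ('a \<Rightarrow> 'a) \<Rightarrow> bool" where
  "monomorphism E' E \<phi> \<longleftrightarrow> inj_on \<phi> (\<Union>E') \<and> (\<forall>x\<in>E'. \<phi> ` x \<in> E)"

definition board :: "nat \<Rightarrow> nat set set" where
  "board k = {e. card e = k}"

(* A strategy maps the history of the game (list of claimed edges in order,
   FP's moves at even positions) to the next edge. It is legal if it always
   claims an unclaimed edge of K^k_N. *)
type_synonym strategy = "nat set list \<Rightarrow> nat set"

definition legal :: "nat \<Rightarrow> strategy \<Rightarrow> bool" where
  "legal k \<sigma> \<longleftrightarrow> (\<forall>h. \<sigma> h \<in> board k \<and> \<sigma> h \<notin> set h)"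

fun hist :: "strategy \<Rightarrow> strategy \<Rightarrow> nat \<Rightarrow> nat set list" where
  "hist \<sigma> \<tau> 0 = []"
| "hist \<sigma> \<tau> (Suc n) = hist \<sigma> \<tau> n @ [(if even n then \<sigma> else \<tau>) (hist \<sigma> \<tau> n)]"

definition fp_edges :: "strategy \<Rightarrow> strategy \<Rightarrow> nat \<Rightarrow> nat set set" where
  "fp_edges \<sigma> \<tau> n = {hist \<sigma> \<tau> n ! i | i. i < n \<and> even i}"

definition sp_edges :: "strategy \<Rightarrow> strategy \<Rightarrow> nat \<Rightarrow> nat set set" where
  "sp_edges \<sigma> \<tau> n = {hist \<sigma> \<tau> n ! i | i. i < n \<and> odd i}"

definition has_copy :: "'a set \<Rightarrow> 'a set set \<Rightarrow> nat set set \<Rightarrow> bool" where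
  "has_copy V E C \<longleftrightarrow> (\<exists>f. inj_on f V \<and> (\<forall>e\<in>E. f ` e \<in> C))"

definition fp_wins :: "'a set \<Rightarrow> 'a set set \<Rightarrow> strategy \<Rightarrow> strategy \<Rightarrow> bool" where
  "fp_wins V E \<sigma> \<tau> \<longleftrightarrow> (\<exists>n. has_copy V E (fp_edges \<sigma> \<tau> n) \<and>
       (\<forall>m\<le>n. \<not> has_copy V E (sp_edges \<sigma> \<tau> m)))"

definition sp_wins :: "'a set \<Rightarrow> 'a set set \<Rightarrow> strategy \<Rightarrow> strategy \<Rightarrow> bool" where
  "sp_wins V E \<sigma> \<tau> \<longleftrightarrow> (\<exists>n. has_copy V E (sp_edges \<sigma> \<tau> n) \<and>
       (\<forall>m\<le>n. \<not> has_copy V E (fp_edges \<sigma> \<tau> m)))"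

definition strong_game_draw :: "nat \<Rightarrow> 'a set \<Rightarrow> 'a set set \<Rightarrow> bool" where
  "strong_game_draw k V E \<longleftrightarrow>
     \<not> (\<exists>\<sigma>. legal k \<sigma> \<and> (\<forall>\<tau>. legal k \<tau> \<longrightarrow> fp_wins V E \<sigma> \<tau>)) \<and>
     \<not> (\<exists>\<tau>. legal k \<tau> \<and> (\<forall>\<sigma>. legal k \<sigma> \<longrightarrow> sp_wins V E \<sigma> \<tau>))"

(* fast winning strategy: the player moving first can ensure a copy of F among
   his edges after |E(F)| of his own moves (i.e. after 2|E(F)| moves in total,
   counting only his edges), regardless of the opponent's copies. *)
definition fast_win :: "nat \<Rightarrow> 'a set \<Rightarrow> 'a set set \<Rightarrow> bool" where
  "fast_win k V E \<longleftrightarrow>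
     (\<exists>\<sigma>. legal k \<sigma> \<and> (\<forall>\<tau>. legal k \<tau> \<longrightarrow> has_copy V E (fp_edges \<sigma> \<tau> (2 * card E))))"

end

(*
  The second player first builds H \ {z} by the fast strategy, off the first edge e1 of the first
  player. If he is then on move and faces no threat (a copy of H minus one edge whose last edge is
  not yet his), he plays for ever: he claims the image of one of r, g with a fresh vertex in the
  role of z, which forces the first player to claim the image of the other. As the fresh vertex has
  degree 1 in the graph of the first player, such a reply can only be a threat if the first player
  owns a copy of H \ {z} fitting it. Rigidity together with (v), respectively the count (vi) inside
  a copy of H containing e1, shows that this cannot happen for both choices of the forcing edge.
  If the first player threatens instead, the second player blocks; by rigidity and the degree
  conditions every further threat consists of the same copy of H \ {z} with one more pendant edge,
  so it has a unique block and the defence goes on until the first player stops threatening.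
  The second player cannot win by strategy stealing.
*)
theory Submission
  imports Defs
begin

section \<open>Strategies\<close>

text \<open>The obstacle is tempo: each reply forced on the first player is also an extra edge for
  him, which might itself be a threat. The lever against this is his first edge \<open>e1\<close>.
  The second player completes his copy of \<open>Ez\<close> in \<open>card E - 2\<close> moves; at
  his next turn the first player owns exactly \<open>card E - 1\<close> edges, so a threat uses all
  of them, \<open>e1\<close> included. Without a threat, (v) keeps \<open>e1\<close> out of every
  copy of \<open>Ez\<close> that fits the forcing edges, so such a copy consists of all his other
  edges and is unique. With a threat, the copies of \<open>Ez\<close> that he owns when the forcing
  starts lie within the vertices of one copy of \<open>H\<close>; two bad roles would place the |r
  \<union> g| - 1 vertices of r \<union> g other than \<open>z\<close> there and off
  \<open>e1\<close>, where only |V| - k vertices remain, and (vi) says that this is too few. The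
  degree bounds are 4 = 2 + 2 and 3 = 1 + 2: after the loss of the two edges that rigidity
  tolerates, or of the one edge just claimed, every vertex other than \<open>z\<close> keeps two
  edges, while a fresh vertex has only one.\<close>

lemma infinite_board:
  assumes "k \<ge> 1"
  shows "infinite (board k)"
proof
  assume fin: "finite (board k)"
  have "inj (\<lambda>v. {v..<v + k})"
    by (rule injI) (metis assms atLeastLessThan_inj(1) less_add_same_cancel1 less_eq_Suc_le One_nat_def)
  moreover have "range (\<lambda>v. {v..<v + k}) \<subseteq> board k"
    by (auto simp: board_def)
  ultimately show False
    using fin by (meson finite_imageD finite_subset infinite_UNIV_nat)
qed

text \<open>A default move: \<open>legal\<close> asks for a legal reply to every history, including
  unreachable ones.\<close>

definition fresh_edge :: "nat \<Rightarrow> strategy" where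
  "fresh_edge k h = (SOME e. e \<in> board k - set h)"

lemma fresh_edge:
  assumes "k \<ge> 1"
  shows "fresh_edge k h \<in> board k - set h"
proof -
  have "infinite (board k - set h)"
    using infinite_board[OF assms] by (simp add: Diff_infinite_finite)
  then have "\<exists>e. e \<in> board k - set h"
    using infinite_imp_nonempty by blast
  then show ?thesis
    unfolding fresh_edge_def by (rule someI_ex)
qed

text \<open>Turns a prescribed play \<open>X\<close> into a legal strategy. As it looks only at the
  history, it can take the side of either player.\<close>

definition replay :: "nat \<Rightarrow> (nat \<Rightarrow> nat set) \<Rightarrow> strategy" where
  "replay k X h = (if h = map X [0..<length h] \<and> X (length h) \<in> board k - set h
     then X (length h) else fresh_edge k h)"

lemma legal_replay: "k \<ge> 1 \<Longrightarrow> legal k (replay k X)"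
  using fresh_edge unfolding legal_def replay_def by auto

lemma replay_map:
  "X n \<in> board k - X ` {..<n} \<Longrightarrow> replay k X (map X [0..<n]) = X n"
  by (simp add: replay_def atLeast0LessThan)

lemma hist_eq_map:
  assumes "\<And>i. i < n \<Longrightarrow> X i = (if even i then \<sigma> else \<tau>) (map X [0..<i])"
  shows "hist \<sigma> \<tau> n = map X [0..<n]"
  using assms by (induction n) auto

lemma length_hist [simp]: "length (hist \<sigma> \<tau> n) = n"
  by (induction n) auto

section \<open>Edge sets of the two players, read off a history\<close>

definition evens :: "'b list \<Rightarrow> 'b set" where
  "evens h = (!) h ` {i. i < length h \<and> even i}"

definition odds :: "'b list \<Rightarrow> 'b set" where
  "odds h = (!) h ` {i. i < length h \<and> odd i}"

lemma fp_edges_evens: "fp_edges \<sigma> \<tau> n = evens (hist \<sigma> \<tau> n)"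
  by (auto simp: fp_edges_def evens_def)

lemma sp_edges_odds: "sp_edges \<sigma> \<tau> n = odds (hist \<sigma> \<tau> n)"
  by (auto simp: sp_edges_def odds_def)

lemma evens_Nil [simp]: "evens [] = {}"
  and odds_Nil [simp]: "odds [] = {}"
  by (simp_all add: evens_def odds_def)

lemma evens_snoc [simp]: "evens (h @ [x]) = (if even (length h) then insert x (evens h) else evens h)"
proof -
  have "{i. i < length (h @ [x]) \<and> even i} = (if even (length h)
      then insert (length h) {i. i < length h \<and> even i} else {i. i < length h \<and> even i})"
    by (auto simp: less_Suc_eq)
  moreover have "(!) (h @ [x]) ` {i. i < length h \<and> even i} = evens h"
    unfolding evens_def by (intro image_cong) (simp_all add: nth_append)
  ultimately show ?thesis by (simp add: evens_def)
qed

lemma odds_snoc [simp]: "odds (h @ [x]) = (if odd (length h) then insert x (odds h) else odds h)"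
proof -
  have "{i. i < length (h @ [x]) \<and> odd i} = (if odd (length h)
      then insert (length h) {i. i < length h \<and> odd i} else {i. i < length h \<and> odd i})"
    by (auto simp: less_Suc_eq)
  moreover have "(!) (h @ [x]) ` {i. i < length h \<and> odd i} = odds h"
    unfolding odds_def by (intro image_cong) (simp_all add: nth_append)
  ultimately show ?thesis by (simp add: odds_def)
qed

lemma evens_single [simp]: "evens [x] = {x}"
  and odds_single [simp]: "odds [x] = {}"
  using evens_snoc[of "[]" x] odds_snoc[of "[]" x] by simp_all

lemma evens_snoc2 [simp]: "evens (h @ [y, x]) = insert (if even (length h) then y else x) (evens h)"
  and odds_snoc2 [simp]: "odds (h @ [y, x]) = insert (if odd (length h) then y else x) (odds h)"
  using evens_snoc[of "h @ [y]" x] odds_snoc[of "h @ [y]" x] by simp_all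

lemma set_evens_odds: "set h = evens h \<union> odds h"
  by (auto simp: evens_def odds_def set_conv_nth)

lemma finite_evens [simp]: "finite (evens h)"
  and finite_odds [simp]: "finite (odds h)"
  using set_evens_odds[of h] by (metis finite_Un List.finite_set)+

lemma has_copy_mono: "has_copy V E C \<Longrightarrow> C \<subseteq> D \<Longrightarrow> has_copy V E D"
  unfolding has_copy_def by blast

text \<open>The invariant \<open>I\<close> is evaluated when it is the second player's turn.\<close>

lemma second_player_invariant:
  assumes k: "k \<ge> 1"
    and start: "\<And>x. x \<in> board k \<Longrightarrow> I [x]"
    and step: "\<And>h. I h \<Longrightarrow> \<exists>y \<in> board k - set h. \<forall>x \<in> board k - insert y (set h). I (h @ [y, x])"
    and safe: "\<And>h. I h \<Longrightarrow> has_copy V E (evens h) \<Longrightarrow> has_copy V E (odds h)"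
  obtains \<tau> where "legal k \<tau>" "\<And>\<sigma>. legal k \<sigma> \<Longrightarrow> \<not> fp_wins V E \<sigma> \<tau>"
proof
  define good where "good h y \<longleftrightarrow> y \<in> board k - set h \<and>
    (\<forall>x \<in> board k - insert y (set h). I (h @ [y, x]))" for h y
  define \<tau> where "\<tau> h = (if \<exists>y. good h y then SOME y. good h y else fresh_edge k h)" for h
  have good: "good h (\<tau> h)" if "I h" for h
  proof -
    have "\<exists>y. good h y" using step[OF that] unfolding good_def by blast
    then show ?thesis by (simp add: \<tau>_def someI_ex)
  qed
  have "\<tau> h \<in> board k - set h" for h
  proof (cases "\<exists>y. good h y")
    case True
    then have "good h (\<tau> h)" by (simp add: \<tau>_def someI_ex)
    then show ?thesis unfolding good_def by blast
  next
    case False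
    then have "\<tau> h = fresh_edge k h" by (simp only: \<tau>_def if_False)
    then show ?thesis using fresh_edge[OF k, of h] by simp
  qed
  then show "legal k \<tau>"
    by (simp add: legal_def)
  fix \<sigma> assume \<sigma>: "legal k \<sigma>"
  have inv: "I (hist \<sigma> \<tau> (Suc (2 * t)))" for t
  proof (induction t)
    case 0
    then show ?case using start \<sigma> by (simp add: legal_def)
  next
    case (Suc t)
    let ?h = "hist \<sigma> \<tau> (Suc (2 * t))"
    have "\<sigma> (?h @ [\<tau> ?h]) \<in> board k - insert (\<tau> ?h) (set ?h)"
      using \<sigma>[unfolded legal_def, rule_format, of "?h @ [\<tau> ?h]"] by simp
    then have "I (?h @ [\<tau> ?h, \<sigma> (?h @ [\<tau> ?h])])"
      using good[OF Suc] unfolding good_def by blast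
    then show ?case by simp
  qed
  have "has_copy V E (sp_edges \<sigma> \<tau> n)" if copy: "has_copy V E (fp_edges \<sigma> \<tau> n)" for n
  proof (cases "even n")
    case False
    then obtain t where "n = Suc (2 * t)" by (auto elim: oddE)
    then show ?thesis
      using safe[OF inv[of t]] copy by (simp only: fp_edges_evens sp_edges_odds)
  next
    case True
    show ?thesis
    proof (cases n)
      case 0
      then show ?thesis using copy by (simp add: fp_edges_def sp_edges_def)
    next
      case (Suc m)
      with True obtain t where m: "m = Suc (2 * t)" by (auto elim: oddE)
      have "evens (hist \<sigma> \<tau> n) = evens (hist \<sigma> \<tau> m)" "odds (hist \<sigma> \<tau> m) \<subseteq> odds (hist \<sigma> \<tau> n)"
        using Suc True by auto
      then show ?thesis
        using safe[OF inv[of t]] copy has_copy_mono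
        by (metis m fp_edges_evens sp_edges_odds)
    qed
  qed
  then show "\<not> fp_wins V E \<sigma> \<tau>"
    unfolding fp_wins_def by blast
qed

fun steal :: "nat \<Rightarrow> strategy \<Rightarrow> nat \<Rightarrow> nat set list \<times> nat set list" where
  "steal k \<tau> 0 = ([fresh_edge k []], [])"
| "steal k \<tau> (Suc n) = (let (p, q) = steal k \<tau> n; s = \<tau> p; f = \<tau> (q @ [s])
     in (p @ [s, if f \<in> set (p @ [s]) then fresh_edge k (p @ [s]) else f], q @ [s, f]))"

text \<open>Strategy stealing: \<open>steal\<close> plays \<open>\<tau>\<close> as second player in two games at once. The first
  component is the real game, the second one an imagined game in which the moves of \<open>\<tau>\<close> in the
  real game are those of the first player. Whenever the imagined reply is already taken in the real
  game, it is an edge that the real first player owns, and he claims an arbitrary edge instead.\<close>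

lemma no_second_player_win:
  assumes k: "k \<ge> 1" and \<tau>: "legal k \<tau>"
  shows "\<exists>\<sigma>. legal k \<sigma> \<and> \<not> sp_wins V E \<sigma> \<tau>"
proof (rule ccontr)
  assume "\<not> ?thesis"
  then have win: "sp_wins V E \<sigma> \<tau>" if "legal k \<sigma>" for \<sigma> using that by blast
  define p where "p n = fst (steal k \<tau> n)" for n
  define q where "q n = snd (steal k \<tau> n)" for n
  define s where "s n = \<tau> (p n)" for n
  define f where "f n = \<tau> (q n @ [s n])" for n
  define e where "e n = (if f n \<in> set (p n @ [s n]) then fresh_edge k (p n @ [s n]) else f n)" for n
  have p0: "p 0 = [fresh_edge k []]" and q0: "q 0 = []" by (simp_all add: p_def q_def)
  have pS: "p (Suc n) = p n @ [s n, e n]" and qS: "q (Suc n) = q n @ [s n, f n]" for n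
    by (simp_all add: p_def q_def s_def f_def e_def Let_def split_beta)
  have lp: "length (p n) = Suc (2 * n)" and lq: "length (q n) = 2 * n" for n
    by (induction n) (simp_all add: p0 q0 pS qS)
  have leg: "\<tau> h \<in> board k" "\<tau> h \<notin> set h" for h
    using \<tau> by (auto simp: legal_def)
  have e: "e n \<in> board k - set (p n @ [s n])" for n
    using fresh_edge[OF k, of "p n @ [s n]"] leg(1)[of "q n @ [s n]"] by (auto simp: e_def f_def)
  have odds_p: "odds (p n) = evens (q n)" for n
    by (induction n) (simp_all add: p0 q0 pS qS lp lq)
  have f_cases: "f n = e n \<or> f n \<in> evens (p n)" for n
  proof -
    have "f n \<noteq> s n" "f n \<notin> evens (q n)"
      using leg(2)[of "q n @ [s n]"] set_evens_odds[of "q n"] by (auto simp: f_def)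
    then show ?thesis
      using odds_p[of n] set_evens_odds[of "p n"] by (auto simp: e_def)
  qed
  have odds_q: "odds (q n) \<subseteq> evens (p n)" for n
  proof (induction n)
    case (Suc n)
    then show ?case using f_cases[of n] by (auto simp: pS qS lp lq)
  qed (simp add: q0)
  \<comment> \<open>Hence a move of \<open>\<tau>\<close> that is new in the real game is also new
    in the imagined one.\<close>
  have set_q: "set (q n) \<subseteq> set (p n)" for n
    using odds_p[of n] odds_q[of n] by (auto simp: set_evens_odds)
  \<comment> \<open>The limit plays. \<open>p i\<close> has length 2i + 1 and contains position i;
    \<open>q i\<close> has length 2i, too short for i = 0, hence \<open>Suc i\<close> in
    \<open>Y\<close>.\<close>
  define X where "X i = p i ! i" for i
  define Y where "Y i = q (Suc i) ! i" for i
  have p_mono: "p (n + d) ! i = p n ! i" if "i < Suc (2 * n)" for n d i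
    using that by (induction d) (simp_all add: pS nth_append lp)
  have q_mono: "q (n + d) ! i = q n ! i" if "i < 2 * n" for n d i
    using that by (induction d) (simp_all add: qS nth_append lq)
  have pX: "p n ! i = X i" if "i < Suc (2 * n)" for n i
    using p_mono[of i n "i - n"] p_mono[of i i "n - i"] that
    by (cases "i \<le> n") (simp_all add: X_def)
  have qY: "q n ! i = Y i" if "i < 2 * n" for n i
    using q_mono[of i n "Suc i - n"] q_mono[of i "Suc i" "n - Suc i"] that
    by (cases "Suc i \<le> n") (simp_all add: Y_def)
  have mapX: "p n = map X [0..<Suc (2 * n)]" for n
    by (rule nth_equalityI) (simp_all add: lp pX del: upt_Suc)
  have mapY: "q n = map Y [0..<2 * n]" for n
    by (rule nth_equalityI) (simp_all add: lq qY)
  have Xodd: "X (Suc (2 * n)) = s n" and Xeven: "X (Suc (Suc (2 * n))) = e n" for n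
    using pX[of "Suc (2 * n)" "Suc n"] pX[of "Suc (Suc (2 * n))" "Suc n"]
    by (simp_all add: pS nth_append lp)
  have Yeven: "Y (2 * n) = s n" and Yodd: "Y (Suc (2 * n)) = f n" for n
    using qY[of "2 * n" "Suc n"] qY[of "Suc (2 * n)" "Suc n"]
    by (simp_all add: qS nth_append lq)
  have mapX': "map X [0..<Suc (Suc (2 * n))] = p n @ [s n]" for n
    by (simp add: mapX Xodd)
  have mapY': "map Y [0..<Suc (2 * n)] = q n @ [s n]" for n
    by (simp add: mapY Yeven)
  have X0: "X 0 = fresh_edge k []" by (simp add: X_def p0)
  have histX: "hist (replay k X) \<tau> n = map X [0..<n]" for n
  proof (rule hist_eq_map)
    fix i
    show "X i = (if even i then replay k X else \<tau>) (map X [0..<i])"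
    proof (cases "even i")
      case False
      then obtain j where "i = Suc (2 * j)" by (auto elim: oddE)
      then show ?thesis using Xodd[of j] mapX[of j] by (simp add: s_def del: upt_Suc)
    next
      case True
      have "X i \<in> board k - set (map X [0..<i])"
      proof (cases i)
        case 0
        then show ?thesis using fresh_edge[OF k, of "[]"] by (simp add: X0)
      next
        case (Suc i')
        with True obtain j where "i = Suc (Suc (2 * j))" by (auto elim: oddE)
        then show ?thesis using Xeven[of j] e[of j] mapX'[of j] by (simp del: upt_Suc)
      qed
      then show ?thesis using True by (simp add: replay_map atLeast0LessThan)
    qed
  qed
  have histY: "hist (replay k Y) \<tau> n = map Y [0..<n]" for n
  proof (rule hist_eq_map)
    fix i
    show "Y i = (if even i then replay k Y else \<tau>) (map Y [0..<i])"
    proof (cases "even i")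
      case False
      then obtain j where "i = Suc (2 * j)" by (auto elim: oddE)
      then show ?thesis using Yodd[of j] mapY'[of j] by (simp add: f_def del: upt_Suc)
    next
      case True
      then obtain j where j: "i = 2 * j" by (auto elim: evenE)
      have "s j \<notin> set (q j)" using leg(2)[of "p j"] set_q[of j] by (auto simp: s_def)
      then have "Y i \<in> board k - set (map Y [0..<i])"
        using leg(1) Yeven[of j] mapY[of j] j by (simp add: s_def)
      then show ?thesis using True by (simp add: replay_map atLeast0LessThan)
    qed
  qed
  \<comment> \<open>Moves of \<open>\<tau>\<close> come one step earlier in the imagined game, where
    they open the round.\<close>
  have spX: "sp_edges (replay k X) \<tau> n \<subseteq> fp_edges (replay k Y) \<tau> (n - 1)" for n
  proof
    fix a assume "a \<in> sp_edges (replay k X) \<tau> n"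
    then obtain i where i: "i < n" "odd i" "a = X i"
      by (auto simp: sp_edges_def histX)
    then obtain j where "i = Suc (2 * j)" by (auto elim: oddE)
    then have "a = Y (2 * j)" "2 * j < n - 1" using i Xodd Yeven by auto
    then show "a \<in> fp_edges (replay k Y) \<tau> (n - 1)"
      by (auto simp: fp_edges_def histY intro!: exI[of _ "2 * j"])
  qed
  have spY: "sp_edges (replay k Y) \<tau> n \<subseteq> fp_edges (replay k X) \<tau> (Suc n)" for n
  proof
    fix a assume "a \<in> sp_edges (replay k Y) \<tau> n"
    then obtain i where i: "i < n" "odd i" "a = Y i"
      by (auto simp: sp_edges_def histY)
    then obtain j where j: "i = Suc (2 * j)" by (auto elim: oddE)
    have "a \<in> odds (q (Suc j))" using i j by (simp add: Yodd qS lq)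
    then have "a \<in> evens (p (Suc j))" using odds_q by blast
    then obtain l where l: "l < Suc (2 * Suc j)" "even l" "a = X l"
      by (auto simp: evens_def lp pX)
    then show "a \<in> fp_edges (replay k X) \<tau> (Suc n)"
      unfolding fp_edges_def histX mem_Collect_eq using i j l
      by (intro exI[of _ l]) (simp del: upt_Suc)
  qed
  obtain n where n: "has_copy V E (sp_edges (replay k X) \<tau> n)"
      "\<And>m. m \<le> n \<Longrightarrow> \<not> has_copy V E (fp_edges (replay k X) \<tau> m)"
    using win[OF legal_replay[OF k]] unfolding sp_wins_def by blast
  obtain n' where n': "has_copy V E (sp_edges (replay k Y) \<tau> n')"
      "\<And>m. m \<le> n' \<Longrightarrow> \<not> has_copy V E (fp_edges (replay k Y) \<tau> m)"
    using win[OF legal_replay[OF k]] unfolding sp_wins_def by blast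
  \<comment> \<open>Each win of \<open>\<tau>\<close> gives its opponent in the other game a copy,
    which must come after the win of \<open>\<tau>\<close> there: n < n' + 1 and n' < n - 1.\<close>
  have "\<not> Suc n' \<le> n" using n(2) n'(1) has_copy_mono[OF _ spY] by blast
  moreover have "\<not> n - 1 \<le> n'" using n'(2) n(1) has_copy_mono[OF _ spX] by blast
  ultimately show False by simp
qed

section \<open>Threats and rigidity\<close>

lemma two_outside:
  assumes "finite B" "card B + 2 \<le> card A"
  obtains a b where "a \<in> A - B" "b \<in> A - B" "a \<noteq> b"
proof -
  have "2 \<le> card (A - B)"
    using diff_card_le_card_Diff[OF assms(1), of A] assms(2) by linarith
  then obtain C where "C \<subseteq> A - B" "card C = 2"
    by (meson obtain_subset_with_card_n)
  then show ?thesis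
    using that by (auto simp: card_2_iff)
qed

locale rigid_hypergraph =
  fixes k :: nat and V :: "'a set" and E :: "'a set set" and z :: 'a and r g :: "'a set"
  assumes k: "k \<ge> 2"
    and unif: "k_uniform k V E"
    and z: "z \<in> V"
    and rg: "{e \<in> E. z \<in> e} = {r, g}" "r \<noteq> g"
    and mindeg: "min_degree_ge (del_vertex_V V z) (del_vertex_E E z) 3"
    and deg4: "\<forall>u \<in> V - {z}. degree E u \<ge> 4"
    and mono: "\<forall>e\<in>E. \<forall>e'\<in>E. e \<noteq> e' \<longrightarrow>
                 (\<forall>\<phi>. monomorphism (E - {e, e'}) E \<phi> \<longrightarrow> (\<forall>a\<in>\<Union>(E - {e, e'}). \<phi> a = a))"
    and inter: "\<forall>e\<in>E. e \<inter> r \<noteq> {} \<and> e \<inter> g \<noteq> {}"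
    and small: "card (V - (r \<union> g)) < k - 1"
begin

section \<open>Incidences at \<open>z\<close>, degrees and rigidity\<close>

definition Ez :: "'a set set" where "Ez = {e \<in> E. z \<notin> e}"

definition other :: "'a set \<Rightarrow> 'a set" where "other c = (if c = r then g else r)"

lemma other: "c \<in> {r, g} \<Longrightarrow> other c \<in> {r, g}" "c \<in> {r, g} \<Longrightarrow> other c \<noteq> c"
    "c \<in> {r, g} \<Longrightarrow> other (other c) = c" "c \<in> {r, g} \<Longrightarrow> {c, other c} = {r, g}"
    "c \<in> {r, g} \<Longrightarrow> d \<in> {r, g} \<Longrightarrow> d \<noteq> c \<Longrightarrow> d = other c"
  using rg(2) by (auto simp: other_def)

lemma finite_V: "finite V" and edge_subset: "e \<in> E \<Longrightarrow> e \<subseteq> V" and edge_card: "e \<in> E \<Longrightarrow> card e = k"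
  using unif by (auto simp: k_uniform_def)

lemma finite_E: "finite E"
  using finite_V edge_subset by (meson Pow_iff finite_Pow_iff finite_subset subsetI)

lemma rgE: "c \<in> {r, g} \<Longrightarrow> c \<in> E" and rgz: "c \<in> {r, g} \<Longrightarrow> z \<in> c"
  using rg(1) by blast+

lemma z_edge: "e \<in> E \<Longrightarrow> z \<in> e \<Longrightarrow> e \<in> {r, g}"
  using rg(1) by blast

lemma E_eq: "E = Ez \<union> {r, g}" and Ez_eq: "E - {r, g} = Ez" and rg_disj: "c \<in> {r, g} \<Longrightarrow> c \<notin> Ez"
  using rgE rgz z_edge by (auto simp: Ez_def)

lemma EzD: "e \<in> Ez \<Longrightarrow> e \<in> E" "e \<in> Ez \<Longrightarrow> e \<subseteq> V - {z}" "e \<in> Ez \<Longrightarrow> e \<notin> {r, g}"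
  using edge_subset rg_disj by (auto simp: Ez_def)

lemma finite_Ez: "finite Ez"
  using finite_E by (simp add: Ez_def)

lemma rg_minus: "c \<in> {r, g} \<Longrightarrow> c - {z} \<subseteq> V - {z}" "c \<in> {r, g} \<Longrightarrow> insert z (c - {z}) = c"
  using edge_subset[OF rgE] insert_Diff[OF rgz] by blast+

lemma card_rg_minus: "c \<in> {r, g} \<Longrightarrow> card (c - {z}) = k - 1"
  using edge_card[OF rgE] rgz by (simp add: card_Diff_singleton)

lemma minus_inj: "c \<in> {r, g} \<Longrightarrow> d \<in> {r, g} \<Longrightarrow> c - {z} = d - {z} \<Longrightarrow> c = d"
  using rg_minus(2) by metis

lemma card_Ez: "card Ez = card E - 2"
  using card_Diff_subset[of "{r, g}" E] rgE rg(2) by (simp add: Ez_eq[symmetric])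

lemma degree_Ez: "u \<in> V - {z} \<Longrightarrow> 3 \<le> card {e \<in> Ez. u \<in> e}"
  using mindeg by (simp add: min_degree_ge_def degree_def del_vertex_V_def del_vertex_E_def Ez_def)

text \<open>Two surviving edges are what distinguishes a vertex of \<open>V - {z}\<close> from a
  pendant vertex of the opponent's graph.\<close>

lemma two_edges_E:
  assumes "u \<in> V - {z}"
  obtains a b where "a \<in> E - {e, h}" "b \<in> E - {e, h}" "a \<noteq> b" "u \<in> a" "u \<in> b"
proof -
  have "card {e, h} \<le> 2" by (simp add: card_insert_if)
  moreover have "4 \<le> card {e \<in> E. u \<in> e}" using deg4 assms by (simp add: degree_def)
  ultimately have "card {e, h} + 2 \<le> card {e \<in> E. u \<in> e}" by linarith
  then obtain a b where "a \<in> {e \<in> E. u \<in> e} - {e, h}" "b \<in> {e \<in> E. u \<in> e} - {e, h}" "a \<noteq> b"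
    by (elim two_outside[rotated]) auto
  then show ?thesis using that by blast
qed

lemma two_edges_Ez:
  assumes "u \<in> V - {z}"
  obtains a b where "a \<in> Ez - {e}" "b \<in> Ez - {e}" "a \<noteq> b" "u \<in> a" "u \<in> b"
proof -
  have "card {e} + 2 \<le> card {e \<in> Ez. u \<in> e}" using degree_Ez[OF assms] by simp
  then obtain a b where "a \<in> {e \<in> Ez. u \<in> e} - {e}" "b \<in> {e \<in> Ez. u \<in> e} - {e}" "a \<noteq> b"
    by (elim two_outside[rotated]) auto
  then show ?thesis using that by blast
qed

lemma V_minus_nonempty: "V - {z} \<noteq> {}"
proof -
  have "card (r - {z}) \<noteq> 0" using card_rg_minus[of r] k by simp
  then have "r - {z} \<noteq> {}" by (metis card.empty)
  then show ?thesis using rg_minus(1)[of r] by blast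
qed

lemma Ez_other: obtains h where "h \<in> Ez" "h \<noteq> e"
  using V_minus_nonempty two_edges_Ez by (metis DiffE equals0I insert_iff)

lemma card_E: "card E \<ge> 3" and card_Ez_pos: "card Ez > 0"
proof -
  show pos: "card Ez > 0" using Ez_other finite_Ez by (metis card_gt_0_iff empty_iff)
  show "card E \<ge> 3" using pos card_Ez by linarith
qed

lemma Union_Ez: "\<Union>Ez = V - {z}"
proof (intro subset_antisym subsetI)
  fix u assume u: "u \<in> V - {z}"
  obtain a where "a \<in> Ez" "u \<in> a" using two_edges_Ez[OF u] by (metis DiffD1)
  then show "u \<in> \<Union>Ez" by blast
qed (use EzD(2) in blast)

text \<open>Only the loss of both edges at \<open>z\<close> uncovers a vertex. In all other cases
  rigidity therefore determines an embedding on the whole of \<open>V\<close>.\<close>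

lemma Union_E_minus:
  assumes "e \<in> E" "e' \<in> E" "{e, e'} \<noteq> {r, g}" 
  shows "\<Union>(E - {e, e'}) = V"
proof
  show "\<Union>(E - {e, e'}) \<subseteq> V" using edge_subset by blast
  have "\<exists>c \<in> {r, g}. c \<notin> {e, e'}" using assms(3) rg(2) by auto
  then have "z \<in> \<Union>(E - {e, e'})" using rgE rgz by blast
  moreover have "u \<in> \<Union>(E - {e, e'})" if "u \<in> V - {z}" for u
    using two_edges_E[OF that, of e e'] by (metis UnionI)
  ultimately show "V \<subseteq> \<Union>(E - {e, e'})" by blast
qed

text \<open>Hypothesis \<open>mono\<close> applied to \<open>inv_into V f \<circ> \<psi>\<close>.
  This carries rigidity from self-maps of \<open>V\<close> to pairs of embeddings into the
  board.\<close>

lemma rigid: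
  fixes f \<psi> :: "'a \<Rightarrow> 'b"
  assumes e: "e \<in> E" "e' \<in> E" "e \<noteq> e'" and f: "inj_on f V" and \<psi>: "inj_on \<psi> (\<Union>(E - {e, e'}))"
    and img: "\<And>x. x \<in> E - {e, e'} \<Longrightarrow> \<psi> ` x \<in> image f ` E"
    and a: "a \<in> \<Union>(E - {e, e'})"
  shows "\<psi> a = f a"
proof -
  define \<chi> where "\<chi> = inv_into V f \<circ> \<psi>"
  have sub: "\<psi> ` \<Union>(E - {e, e'}) \<subseteq> f ` V" using img edge_subset by blast
  have "inj_on \<chi> (\<Union>(E - {e, e'}))"
    unfolding \<chi>_def using sub by (intro comp_inj_on \<psi>) (meson inj_on_inv_into inj_on_subset)
  moreover have "\<chi> ` x \<in> E" if x: "x \<in> E - {e, e'}" for x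
  proof -
    obtain y where y: "y \<in> E" "\<psi> ` x = f ` y" using img[OF x] by blast
    have "\<chi> ` x = inv_into V f ` f ` y" unfolding \<chi>_def image_comp[symmetric] y(2) ..
    then have "\<chi> ` x = y"
      using f edge_subset[OF y(1)] by (simp add: inv_into_image_cancel)
    then show ?thesis using y by simp
  qed
  ultimately have "\<chi> a = a" using mono e a unfolding monomorphism_def by blast
  moreover have "\<psi> a \<in> f ` V" using sub a by blast
  then have "f (\<chi> a) = \<psi> a" by (simp add: \<chi>_def f_inv_into_f)
  ultimately show ?thesis by simp
qed

lemma rigid_V:
  fixes f \<psi> :: "'a \<Rightarrow> 'b"
  assumes "e \<in> E" "e' \<in> E" "e \<noteq> e'" "inj_on f V" "inj_on \<psi> V"
    and "\<And>x. x \<in> E - {e, e'} \<Longrightarrow> \<psi> ` x \<in> image f ` E" and "a \<in> \<Union>(E - {e, e'})"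
  shows "\<psi> a = f a"
proof (rule rigid[OF assms(1-4) _ assms(6,7)])
  show "inj_on \<psi> (\<Union>(E - {e, e'}))"
    using assms(5) edge_subset by (elim inj_on_subset) blast
qed

lemma inj_image_eq: "inj_on f V \<Longrightarrow> e \<in> E \<Longrightarrow> h \<in> E \<Longrightarrow> f ` e = f ` h \<longleftrightarrow> e = h"
  by (meson edge_subset inj_on_image_eq_iff)

lemma inj_image_eq': "inj_on f (V - {z}) \<Longrightarrow> e \<in> Ez \<Longrightarrow> h \<in> Ez \<Longrightarrow> f ` e = f ` h \<longleftrightarrow> e = h"
  by (meson EzD(2) inj_on_image_eq_iff)

lemma image_in_board: "inj_on f V \<Longrightarrow> e \<in> E \<Longrightarrow> f ` e \<in> board k"
  by (simp add: board_def card_image edge_card edge_subset inj_on_subset)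

section \<open>Threats, and how one new edge creates them\<close>

definition threat :: "('a \<Rightarrow> nat) \<Rightarrow> 'a set \<Rightarrow> nat set set \<Rightarrow> bool" where
  "threat \<psi> e F \<longleftrightarrow> inj_on \<psi> V \<and> e \<in> E \<and> (\<forall>x \<in> E - {e}. \<psi> ` x \<in> F)"

text \<open>A \<open>threat\<close> need not have a free last edge. A complete copy in
  \<open>F\<close> is thus a threat too, so \<open>blocked\<close> excludes copies as soon as
  \<open>F\<close> and \<open>S\<close> are disjoint.\<close>

definition blocked :: "nat set set \<Rightarrow> nat set set \<Rightarrow> bool" where
  "blocked F S \<longleftrightarrow> (\<forall>\<psi> e. threat \<psi> e F \<longrightarrow> \<psi> ` e \<in> S)"

text \<open>By injectivity \<open>x\<close> is the image of at most one edge, so a copy was already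
  a threat before \<open>x\<close>, and the image of its missing edge belongs to
  \<open>S\<close>.\<close>

lemma blocked_insert_no_copy:
  assumes bl: "blocked F S" and disj: "insert x F \<inter> S = {}"
  shows "\<not> has_copy V E (insert x F)"
proof
  assume "has_copy V E (insert x F)"
  then obtain f where f: "inj_on f V" "\<And>e. e \<in> E \<Longrightarrow> f ` e \<in> insert x F"
    unfolding has_copy_def by blast
  obtain h where h: "h \<in> E" "\<And>e. e \<in> E - {h} \<Longrightarrow> f ` e \<noteq> x"
    using inj_image_eq[OF f(1)] rgE[of r] by (metis Diff_iff insertCI)
  then have "threat f h F" using f unfolding threat_def by blast
  then show False using bl f(2) h(1) disj unfolding blocked_def by blast
qed

lemma blocked_no_copy:
  assumes "blocked F S" "F \<inter> S = {}"
  shows "\<not> has_copy V E F"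
proof
  assume "has_copy V E F"
  moreover from this obtain f where "\<forall>e \<in> E. f ` e \<in> F" unfolding has_copy_def by blast
  then have "insert (f ` r) F = F" using rgE[of r] by (simp add: insert_absorb)
  ultimately show False using blocked_insert_no_copy[OF assms(1), of "f ` r"] assms(2) by simp
qed

lemma image_edge_cong: "(\<And>v. v \<in> V \<Longrightarrow> f v = f' v) \<Longrightarrow> x \<in> E \<Longrightarrow> f ` x = f' ` x"
  by (meson edge_subset image_cong subsetD)

lemma unique_threat:
  assumes f: "inj_on f V" "e \<in> E" and th: "threat \<psi> e' (image f ` (E - {e}))"
  shows "\<psi> ` e' = f ` e"
proof -
  \<comment> \<open>Giving up a further edge away from \<open>z\<close> fits the two-edge form of
    rigidity while leaving \<open>z\<close> covered.\<close>
  obtain h where h: "h \<in> Ez" "h \<noteq> e'" using Ez_other by blast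
  have \<psi>: "inj_on \<psi> V" "e' \<in> E" "\<And>x. x \<in> E - {e'} \<Longrightarrow> \<psi> ` x \<in> image f ` (E - {e})"
    using th by (auto simp: threat_def)
  have U: "\<Union>(E - {e', h}) = V" using \<psi>(2) h EzD by (intro Union_E_minus) blast+
  have eq: "\<psi> v = f v" if "v \<in> V" for v
  proof (rule rigid_V[OF _ _ _ f(1) \<psi>(1)])
    show "e' \<in> E" "h \<in> E" "e' \<noteq> h" "v \<in> \<Union>(E - {e', h})" using \<psi>(2) h U that EzD(1) by simp_all
    show "\<psi> ` y \<in> image f ` E" if "y \<in> E - {e', h}" for y using \<psi>(3)[of y] that by blast
  qed
  have "e' = e"
  proof (rule ccontr)
    assume "e' \<noteq> e"
    then have "\<psi> ` e \<in> image f ` (E - {e})" using \<psi>(3) f(2) by blast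
    moreover have "\<psi> ` e = f ` e" using eq f(2) by (rule image_edge_cong)
    ultimately show False using inj_image_eq[OF f(1)] f(2) by auto
  qed
  then show ?thesis using image_edge_cong[of \<psi> f, OF eq f(2)] by simp
qed

text \<open>With \<open>card E - 1\<close> edges none is to spare: the threat is the entire graph of
  the first player.\<close>

lemma threat_card:
  assumes th: "threat f e F" and F: "finite F" "card F = card E - 1"
  shows "F = image f ` (E - {e})"
proof -
  have f: "inj_on f V" "e \<in> E" "image f ` (E - {e}) \<subseteq> F" using th by (auto simp: threat_def)
  have "inj_on (image f) (E - {e})" using inj_image_eq[OF f(1)] by (auto intro: inj_onI)
  then have "card (image f ` (E - {e})) = card F" using f(2) F(2) by (simp add: card_image)
  then show ?thesis using f(3) F(1) by (metis card_subset_eq)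
qed

text \<open>Without its missing edge \<open>e\<close> and the edge \<open>h\<close> sent to
  \<open>x\<close>, a new threat lives in the old graph. This is why rigidity is needed for the
  deletion of two edges.\<close>

lemma new_threat_edge:
  assumes bl: "blocked F S" and th: "threat \<psi> e (insert x F)" and op: "\<psi> ` e \<notin> S"
  obtains h where "h \<in> E - {e}" "\<psi> ` h = x" "\<And>y. y \<in> E - {e, h} \<Longrightarrow> \<psi> ` y \<in> F"
proof -
  have \<psi>: "inj_on \<psi> V" "e \<in> E" "\<And>y. y \<in> E - {e} \<Longrightarrow> \<psi> ` y \<in> insert x F"
    using th by (auto simp: threat_def)
  have "\<not> threat \<psi> e F" using bl op unfolding blocked_def by meson
  then obtain h where h: "h \<in> E - {e}" "\<psi> ` h \<notin> F" using \<psi>(1,2) unfolding threat_def by meson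
  have hx: "\<psi> ` h = x" using \<psi>(3)[OF h(1)] h(2) by simp
  have "\<psi> ` y \<in> F" if y: "y \<in> E - {e, h}" for y
  proof -
    have "y \<in> E" "h \<in> E" "y \<noteq> h" "y \<in> E - {e}" using y h(1) by simp_all
    then have "\<psi> ` y \<noteq> x" using inj_image_eq[OF \<psi>(1)] hx by metis
    then show ?thesis using \<psi>(3)[OF \<open>y \<in> E - {e}\<close>] by simp
  qed
  then show ?thesis using that[OF h(1) hx] by blast
qed

text \<open>The image of \<open>e\<close> is absent from the old graph, so \<open>e\<close> is one
  of the two edges given up. As \<open>e\<close> avoids \<open>z\<close>, these are not
  \<open>r\<close> and \<open>g\<close>, and \<open>\<psi>\<close> agrees with \<open>f\<close> on
  \<open>V\<close>. Then the blocked image of \<open>e\<close> would be \<open>x\<close> or the open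
  edge.\<close>

lemma no_new_threat:
  assumes f: "inj_on f V" "e \<in> Ez" and bl: "blocked (image f ` (E - {e})) S" and x: "x \<notin> S"
  shows "blocked (insert x (image f ` (E - {e}))) S"
  unfolding blocked_def
proof (intro allI impI, rule ccontr)
  fix \<psi> e'
  assume th: "threat \<psi> e' (insert x (image f ` (E - {e})))" and open_threat: "\<psi> ` e' \<notin> S"
  have \<psi>: "inj_on \<psi> V" "e' \<in> E" "\<And>y. y \<in> E - {e'} \<Longrightarrow> \<psi> ` y \<in> insert x (image f ` (E - {e}))"
    using th by (auto simp: threat_def)
  obtain h where h: "h \<in> E - {e'}" "\<psi> ` h = x"
      and img: "\<And>y. y \<in> E - {e', h} \<Longrightarrow> \<psi> ` y \<in> image f ` (E - {e})"
    by (rule new_threat_edge[OF bl th open_threat]) (rule that)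
  have fe: "f ` e \<in> S" using bl f EzD(1) by (auto simp: blocked_def threat_def)
  have eq: "\<psi> v = f v" if v: "v \<in> \<Union>(E - {e', h})" for v
  proof (rule rigid_V[OF _ _ _ f(1) \<psi>(1) _ v])
    show "\<psi> ` y \<in> image f ` E" if "y \<in> E - {e', h}" for y
      using img[OF that] by blast
  qed (use \<psi>(2) h(1) in blast)+
  have e: "e \<in> {e', h}"
  proof (rule ccontr)
    assume n: "e \<notin> {e', h}"
    then have "e \<in> E - {e', h}" using f(2) EzD(1) by simp
    then have "\<psi> ` e = f ` e" "\<psi> ` e \<in> image f ` (E - {e})"
      using eq img by (auto intro!: image_cong)
    then show False using inj_image_eq[OF f(1)] EzD(1)[OF f(2)] by auto
  qed
  then have "{e', h} \<noteq> {r, g}" using EzD(3)[OF f(2)] by blast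
  then have "\<Union>(E - {e', h}) = V" by (rule Union_E_minus[OF \<psi>(2) DiffD1[OF h(1)]])
  then have "\<psi> ` e = f ` e" using eq EzD(1)[OF f(2)] by (intro image_edge_cong) simp_all
  then show False using e fe open_threat x h(2) by auto
qed

text \<open>Each \<open>v \<in> Z\<close> is a candidate for the role of \<open>z\<close>, holding
  just one of its two edges, namely \<open>c v\<close>; the other one would complete a copy of
  \<open>H\<close>.\<close>

definition pendant_structure :: "('a \<Rightarrow> nat) \<Rightarrow> (nat \<Rightarrow> 'a set) \<Rightarrow> nat set \<Rightarrow> nat set set \<Rightarrow> bool" where
  "pendant_structure f c Z F \<longleftrightarrow> inj_on f (V - {z}) \<and> Z \<inter> f ` (V - {z}) = {} \<and> (\<forall>v \<in> Z. c v \<in> {r, g}) \<and>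
     F = image f ` Ez \<union> (\<lambda>v. insert v (f ` (c v - {z}))) ` Z"

lemma pendant_edge:
  assumes ps: "pendant_structure f c Z F" and p: "p \<in> F" "v \<in> p" "v \<notin> f ` (V - {z})"
  shows "v \<in> Z \<and> p = insert v (f ` (c v - {z}))"
proof -
  have "p \<in> image f ` Ez \<or> p \<in> (\<lambda>v. insert v (f ` (c v - {z}))) ` Z"
    using ps p(1) by (auto simp: pendant_structure_def)
  then show ?thesis
  proof
    assume "p \<in> image f ` Ez"
    then have "p \<subseteq> f ` (V - {z})" using EzD(2) by blast
    then show ?thesis using p by blast
  next
    assume "p \<in> (\<lambda>v. insert v (f ` (c v - {z}))) ` Z"
    then obtain w where w: "w \<in> Z" "p = insert w (f ` (c w - {z}))" by blast
    have "c w \<in> {r, g}" using ps w(1) by (simp add: pendant_structure_def)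
    then have "f ` (c w - {z}) \<subseteq> f ` (V - {z})" by (intro image_mono rg_minus(1))
    then have "v = w" using p w(2) by blast
    then show ?thesis using w by simp
  qed
qed

lemma image_upd: "f(z := v) ` c = insert v (f ` (c - {z}))" if "c \<in> {r, g}"
proof -
  have "f(z := v) ` insert z (c - {z}) = insert v (f ` (c - {z}))" by auto
  then show ?thesis by (simp only: rg_minus(2)[OF that])
qed

lemma image_upd_Ez: "e \<in> Ez \<Longrightarrow> f(z := v) ` e = f ` e"
  using EzD(2) by (intro image_cong) auto

lemma inj_upd: "inj_on f (V - {z}) \<Longrightarrow> v \<notin> f ` (V - {z}) \<Longrightarrow> inj_on (f(z := v)) V"
  by (auto simp: inj_on_def)

text \<open>Rigidity together with the degree conditions leaves only one way to create a new threat: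
  a second neighbour for \<open>z\<close>, i.e. another pendant edge with a fresh pendant vertex.\<close>

lemma pendant_threat:
  assumes ps: "pendant_structure f c Z F" and bl: "blocked F S" and x: "x \<notin> F" "x \<notin> S"
    and th: "threat \<psi> e (insert x F)" and open_threat: "\<psi> ` e \<notin> S"
  obtains v h where "h \<in> {r, g}" "v \<notin> f ` (V - {z})" "v \<notin> Z"
    "x = insert v (f ` (h - {z}))" "\<psi> ` e = insert v (f ` (other h - {z}))"
proof -
  have f: "inj_on f (V - {z})" and Z: "Z \<inter> f ` (V - {z}) = {}" and c: "\<And>v. v \<in> Z \<Longrightarrow> c v \<in> {r, g}"
    and F: "F = image f ` Ez \<union> (\<lambda>v. insert v (f ` (c v - {z}))) ` Z"
    using ps by (auto simp: pendant_structure_def)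
  have \<psi>: "inj_on \<psi> V" "e \<in> E" "\<And>y. y \<in> E - {e} \<Longrightarrow> \<psi> ` y \<in> insert x F"
    using th by (auto simp: threat_def)
  obtain h where h: "h \<in> E - {e}" "\<psi> ` h = x"
      and img: "\<And>y. y \<in> E - {e, h} \<Longrightarrow> \<psi> ` y \<in> F"
    by (rule new_threat_edge[OF bl th open_threat]) (rule that)
  note pend = pendant_edge[OF ps]
  \<comment> \<open>Two edges at \<open>u\<close> survive without \<open>e\<close> and
    \<open>h\<close>, but a vertex off the core has only one.\<close>
  have \<psi>V: "\<psi> u \<in> f ` (V - {z})" if u: "u \<in> V - {z}" for u
  proof (rule ccontr)
    assume n: "\<psi> u \<notin> f ` (V - {z})"
    obtain a b where ab: "a \<in> E - {e, h}" "b \<in> E - {e, h}" "a \<noteq> b" "u \<in> a" "u \<in> b"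
      by (rule two_edges_E[OF u, of e h]) (rule that)
    have "\<psi> ` a = \<psi> ` b"
      using pend[OF img[OF ab(1)] imageI[OF ab(4)] n] pend[OF img[OF ab(2)] imageI[OF ab(5)] n]
      by metis
    then show False using inj_image_eq[OF \<psi>(1)] ab by (metis DiffD1)
  qed
  have \<psi>V_eq: "\<psi> ` (V - {z}) = f ` (V - {z})"
  proof (rule card_subset_eq)
    have "inj_on \<psi> (V - {z})" using \<psi>(1) by (rule inj_on_subset) auto
    then show "card (\<psi> ` (V - {z})) = card (f ` (V - {z}))" using f by (simp add: card_image)
    show "\<psi> ` (V - {z}) \<subseteq> f ` (V - {z})" using \<psi>V by (rule image_subsetI)
  qed (simp add: finite_V)
  define v where "v = \<psi> z"
  have v: "v \<notin> f ` (V - {z})"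
    using inj_on_image_mem_iff[OF \<psi>(1) z, of "V - {z}"] unfolding \<psi>V_eq[symmetric] v_def by blast
  \<comment> \<open>The reference copy for rigidity: the core with \<open>z\<close> placed where
    \<open>\<psi>\<close> puts it.\<close>
  define f' where "f' = f(z := v)"
  have f': "inj_on f' V" using inj_upd[OF f v] by (simp add: f'_def)
  have f'z: "f' ` d = insert v (f ` (d - {z}))" if "d \<in> {r, g}" for d
    unfolding f'_def using that by (rule image_upd)
  have f'Ez: "f' ` d = f ` d" if "d \<in> Ez" for d
    unfolding f'_def using that by (rule image_upd_Ez)
  have img_Ez: "\<psi> ` y \<in> image f ` Ez" if "y \<in> E - {e, h}" "y \<in> Ez" for y
  proof -
    have "\<psi> ` y \<subseteq> f ` (V - {z})" using EzD(2)[OF that(2)] \<psi>V by blast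
    moreover have "\<psi> ` y \<notin> (\<lambda>v. insert v (f ` (c v - {z}))) ` Z"
    proof
      assume "\<psi> ` y \<in> (\<lambda>v. insert v (f ` (c v - {z}))) ` Z"
      then obtain w where "w \<in> Z" "w \<in> \<psi> ` y" by blast
      then show False using calculation Z by blast
    qed
    ultimately show ?thesis using img[OF that(1)] unfolding F by simp
  qed
  have img_rg: "v \<in> Z \<and> \<psi> ` y = f' ` c v" if "y \<in> E - {e, h}" "y \<in> {r, g}" for y
  proof -
    have "v \<in> \<psi> ` y" using rgz[OF that(2)] by (simp add: v_def)
    then show ?thesis using pend[OF img[OF that(1)] _ v] f'z[OF c] by metis
  qed
  have eq: "\<psi> u = f' u" if u: "u \<in> \<Union>(E - {e, h})" for u
  proof (rule rigid_V[OF _ _ _ f' \<psi>(1) _ u])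
    fix y assume y: "y \<in> E - {e, h}"
    then consider "y \<in> Ez" | "y \<in> {r, g}" using E_eq by blast
    then show "\<psi> ` y \<in> image f' ` E"
    proof cases
      case 1
      obtain d where "d \<in> Ez" "\<psi> ` y = f ` d" using img_Ez[OF y 1] by (rule imageE)
      then show ?thesis using f'Ez EzD(1) by (metis image_eqI)
    next
      case 2
      then have "\<psi> ` y = f' ` c v" "c v \<in> E" using img_rg[OF y 2] rgE[OF c] by simp_all
      then show ?thesis by simp
    qed
  qed (use \<psi>(2) h(1) in blast)+
  \<comment> \<open>Owning one edge at \<open>v\<close> is already a threat, so by \<open>bl\<close>
    the other edge at \<open>v\<close> is in \<open>S\<close>.\<close>
  have pend_block: "f' ` other d \<in> S" if "d \<in> {r, g}" "f' ` d \<in> F" for d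
  proof -
    have "f' ` y \<in> F" if y: "y \<in> E - {other d}" for y
    proof -
      consider "y \<in> Ez" | "y = d" using y E_eq other(4)[OF \<open>d \<in> {r, g}\<close>] by blast
      then show ?thesis
      proof cases
        case 1
        then show ?thesis using f'Ez[OF 1] unfolding F by simp
      qed (use \<open>f' ` d \<in> F\<close> in simp)
    qed
    then have "threat f' (other d) F"
      using f' other(1)[OF that(1)] rgE by (auto simp: threat_def)
    then show ?thesis using bl by (auto simp: blocked_def)
  qed
  \<comment> \<open>Otherwise \<open>\<psi>\<close> agrees with \<open>f'\<close> on
    \<open>V\<close> and one edge \<open>d\<close> at \<open>z\<close> survives. If the other edge
    at \<open>z\<close> is \<open>e\<close> or \<open>h\<close>, its image is in \<open>S\<close> by
    \<open>pend_block\<close>; if it survives as well, both have the same pendant image.\<close>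
  have eh: "{e, h} = {r, g}"
  proof (rule ccontr)
    assume n: "{e, h} \<noteq> {r, g}"
    then have U: "\<Union>(E - {e, h}) = V" by (rule Union_E_minus[OF \<psi>(2) DiffD1[OF h(1)]])
    then have eqE: "\<psi> ` y = f' ` y" if "y \<in> E" for y
      using eq that by (intro image_edge_cong) simp_all
    obtain d where d: "d \<in> {r, g}" "d \<notin> {e, h}" using n rg(2) by auto
    have dE: "d \<in> E - {e, h}" using d rgE by blast
    have dimg: "\<psi> ` d = f' ` c v" using img_rg[OF dE d(1)] by simp
    have "\<psi> ` d \<in> F" by (rule img[OF dE])
    then have S: "f' ` other d \<in> S" using pend_block[OF d(1)] eqE rgE[OF d(1)] by simp
    show False
    proof (cases "other d \<in> {e, h}")
      case True
      then have "other d = e \<or> other d = h" by simp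
      then show ?thesis
        using S open_threat x(2) h(2) eqE[OF \<psi>(2)] eqE[OF DiffD1[OF h(1)]] by metis
    next
      case False
      have o: "other d \<in> {r, g}" "other d \<noteq> d" by (rule other(1,2)[OF d(1)])+
      have "other d \<in> E - {e, h}" using False rgE[OF o(1)] by simp
      then have "\<psi> ` other d = \<psi> ` d" using img_rg[OF _ o(1)] dimg by simp
      then show ?thesis using inj_image_eq[OF \<psi>(1) rgE[OF o(1)] rgE[OF d(1)]] o(2) by simp
    qed
  qed
  then have h_rg: "h \<in> {r, g}" by blast
  have e_def: "e = other h" using eh h(1) by (intro other(5)[OF h_rg]) blast+
  have on_V: "\<psi> u = f u" if "u \<in> V - {z}" for u
  proof -
    have "u \<in> \<Union>(E - {e, h})" using that Union_Ez Ez_eq eh by simp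
    then show ?thesis using eq that by (simp add: f'_def)
  qed
  have img_h: "\<psi> ` d = f' ` d" if "d \<in> {r, g}" for d
  proof (rule image_cong)
    show "\<psi> u = f' u" if "u \<in> d" for u
      using edge_subset[OF rgE[OF \<open>d \<in> {r, g}\<close>]] on_V[of u] that
      by (cases "u = z") (auto simp: f'_def v_def)
  qed simp
  have x_eq: "x = f' ` h" using img_h h_rg h(2) by simp
  \<comment> \<open>For \<open>v \<in> Z\<close> the edge \<open>x\<close> would be the second edge
    at \<open>v\<close>, which \<open>S\<close> already contains.\<close>
  have "v \<notin> Z"
  proof
    assume "v \<in> Z"
    then have cv: "c v \<in> {r, g}" by (rule c)
    have F': "f' ` c v \<in> F" unfolding F f'z[OF cv] using \<open>v \<in> Z\<close> by blast
    then have "c v \<noteq> h" using x(1) x_eq by metis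
    then have "c v = other h" by (rule other(5)[OF h_rg cv])
    then have "f' ` h \<in> S" using pend_block[OF cv F'] other(3)[OF h_rg] by simp
    then show False using x(2) x_eq by simp
  qed
  then show ?thesis
    using that[OF h_rg v] x_eq f'z[OF h_rg] img_h[OF other(1)[OF h_rg]] f'z[OF other(1)[OF h_rg]] e_def by simp
qed

end

section \<open>The drawing strategy\<close>

lemma insert_fresh_eq:
  assumes "insert v A = insert w B" "A \<subseteq> C" "B \<subseteq> C" "v \<notin> C" "w \<notin> C"
  shows "v = w" "A = B"
proof -
  show "v = w" using assms by blast
  then show "A = B" using assms by (metis insert_ident subsetD)
qed

context rigid_hypergraph
begin

definition copy_Ez :: "('a \<Rightarrow> nat) \<Rightarrow> nat set set \<Rightarrow> bool" where
  "copy_Ez \<psi> F \<longleftrightarrow> inj_on \<psi> (V - {z}) \<and> image \<psi> ` Ez \<subseteq> F"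

text \<open>If the second player owns the copy \<open>\<phi>\<close> of \<open>Ez\<close>, he can claim \<open>\<phi> ` (other b - {z})\<close> plus a
  fresh vertex, forcing the first player to claim \<open>\<phi> ` (b - {z})\<close> plus that vertex. The role \<open>b\<close> is
  bad for this if the forced reply may in turn be a threat of the first player.\<close>

definition bad :: "('a \<Rightarrow> nat) \<Rightarrow> nat set set \<Rightarrow> 'a set \<Rightarrow> bool" where
  "bad \<phi> F b \<longleftrightarrow> (\<exists>\<psi> c. copy_Ez \<psi> F \<and> c \<in> {r, g} \<and>
     \<psi> ` (c - {z}) = \<phi> ` (b - {z}) \<and> \<psi> ` (other c - {z}) \<noteq> \<phi> ` (other b - {z}))"

lemma minus_image_eq:
  assumes "inj_on f (V - {z})" "c \<in> {r, g}" "d \<in> {r, g}"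
  shows "f ` (c - {z}) = f ` (d - {z}) \<longleftrightarrow> c = d"
  using inj_on_image_eq_iff[OF assms(1) rg_minus(1)[OF assms(2)] rg_minus(1)[OF assms(3)]]
    minus_inj[OF assms(2,3)] by blast

lemma Ez_extend:
  fixes \<psi> :: "'a \<Rightarrow> nat"
  assumes "inj_on \<psi> (V - {z})"
  obtains w where "inj_on (\<psi>(z := w)) V"
proof -
  obtain w where "w \<notin> \<psi> ` (V - {z})"
    using ex_new_if_finite[OF infinite_UNIV_nat] finite_V by (metis finite_Diff finite_imageI)
  then show ?thesis using that inj_upd[OF assms] by blast
qed

text \<open>Rigidity for the deleted pair \<open>r\<close>, \<open>g\<close>. The value at
  \<open>z\<close> is chosen arbitrarily, subject to injectivity.\<close>

lemma Ez_rigid: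
  fixes \<psi> \<psi>' :: "'a \<Rightarrow> nat"
  assumes inj: "inj_on \<psi> (V - {z})" "inj_on \<psi>' (V - {z})" and eq: "image \<psi> ` Ez = image \<psi>' ` Ez"
    and u: "u \<in> V - {z}"
  shows "\<psi> u = \<psi>' u"
proof -
  obtain w where w: "inj_on (\<psi>'(z := w)) V" using Ez_extend[OF inj(2)] .
  have "\<psi> u = (\<psi>'(z := w)) u"
  proof (rule rigid[of r g])
    show "r \<in> E" "g \<in> E" "r \<noteq> g" "inj_on (\<psi>'(z := w)) V" using rgE rg(2) w by simp_all
    show "inj_on \<psi> (\<Union>(E - {r, g}))" "u \<in> \<Union>(E - {r, g})" using inj(1) u by (simp_all add: Ez_eq Union_Ez)
    fix x assume "x \<in> E - {r, g}"
    then have "\<psi> ` x \<in> image \<psi>' ` Ez" using eq Ez_eq by blast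
    then obtain y where y: "y \<in> Ez" "\<psi> ` x = \<psi>' ` y" by (rule imageE)
    then have "\<psi> ` x = \<psi>'(z := w) ` y" by (simp only: image_upd_Ez)
    then show "\<psi> ` x \<in> image (\<psi>'(z := w)) ` E" using EzD(1)[OF y(1)] by (rule image_eqI)
  qed
  then show ?thesis using u by simp
qed

lemma card_image_Ez:
  assumes "inj_on \<psi> (V - {z})"
  shows "card (image \<psi> ` Ez) = card Ez"
  by (rule card_image) (use inj_image_eq'[OF assms] in \<open>simp add: inj_on_def\<close>)

text \<open>Both witnesses of badness would be the same copy \<open>F - {e1}\<close>; it would then
  match both forcing edges at once, whereas badness requires a mismatch.\<close>

lemma not_both_bad_initial:
  assumes \<phi>: "inj_on \<phi> (V - {z})" and F: "finite F" "card F = card E - 1"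
    and e1: "e1 \<in> F" "e1 \<inter> \<phi> ` (V - {z}) = {}"
  obtains b where "b \<in> {r, g}" "\<not> bad \<phi> F b"
proof -
  have img: "image \<psi> ` Ez = F - {e1}"
    if \<psi>: "copy_Ez \<psi> F" and c: "c \<in> {r, g}" "b \<in> {r, g}" and cb: "\<psi> ` (c - {z}) = \<phi> ` (b - {z})" for \<psi> c b
  proof -
    \<comment> \<open>By \<open>inter\<close> every edge of the copy meets the image of
      \<open>c - {z}\<close>, which lies in the second player's copy, and \<open>e1\<close> avoids
      that copy.\<close>
    have "e1 \<notin> image \<psi> ` Ez"
    proof
      assume "e1 \<in> image \<psi> ` Ez"
      then obtain h where h: "h \<in> Ez" "e1 = \<psi> ` h" by blast
      have "h \<inter> c \<noteq> {}" using inter EzD(1)[OF h(1)] c(1) by blast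
      then obtain u where u: "u \<in> h" "u \<in> c" by blast
      then have "u \<in> c - {z}" using EzD(2)[OF h(1)] by blast
      then have "\<psi> u \<in> \<phi> ` (b - {z})" using cb by blast
      also have "\<dots> \<subseteq> \<phi> ` (V - {z})" by (intro image_mono rg_minus(1) c(2))
      finally show False using e1(2) h(2) u(1) by blast
    qed
    then have "image \<psi> ` Ez \<subseteq> F - {e1}" using \<psi> by (auto simp: copy_Ez_def)
    moreover have "card (image \<psi> ` Ez) = card (F - {e1})"
      using card_image_Ez[of \<psi>] \<psi> F e1(1) card_Ez by (simp add: copy_Ez_def)
    ultimately show ?thesis using F(1) by (simp add: card_subset_eq)
  qed
  have other_rg: "other r = g" "other g = r" by (simp_all add: other_def)
  have "\<not> (bad \<phi> F r \<and> bad \<phi> F g)"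
  proof
    assume "bad \<phi> F r \<and> bad \<phi> F g"
    then obtain \<psi> c \<psi>' c' where
      \<psi>: "copy_Ez \<psi> F" "c \<in> {r, g}" "\<psi> ` (c - {z}) = \<phi> ` (r - {z})"
        "\<psi> ` (other c - {z}) \<noteq> \<phi> ` (g - {z})" and
      \<psi>': "copy_Ez \<psi>' F" "c' \<in> {r, g}" "\<psi>' ` (c' - {z}) = \<phi> ` (g - {z})"
        "\<psi>' ` (other c' - {z}) \<noteq> \<phi> ` (r - {z})"
      unfolding bad_def other_rg by (elim conjE exE) (rule that)
    have "image \<psi> ` Ez = image \<psi>' ` Ez"
      using img[OF \<psi>(1,2) _ \<psi>(3)] img[OF \<psi>'(1,2) _ \<psi>'(3)] by simp
    then have "\<psi> u = \<psi>' u" if "u \<in> V - {z}" for u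
      using \<psi>(1) \<psi>'(1) that by (intro Ez_rigid) (simp_all add: copy_Ez_def)
    then have eq: "\<psi> ` (d - {z}) = \<psi>' ` (d - {z})" if "d \<in> {r, g}" for d
      using rg_minus(1)[OF that] by (intro image_cong) auto
    have "c' \<noteq> c" using eq[OF \<psi>(2)] \<psi>(3) \<psi>'(3) minus_image_eq[OF \<phi>, of r g] rg(2) by auto
    then have "c' = other c" by (rule other(5)[OF \<psi>(2) \<psi>'(2)])
    then show False using \<psi>(4) \<psi>'(3) eq[OF \<psi>'(2)] by simp
  qed
  then show ?thesis using that by blast
qed

lemma not_both_bad_confined:
  assumes \<phi>: "inj_on \<phi> (V - {z})" and f: "inj_on f V" "e1 \<in> image f ` E"
    and e1: "e1 \<inter> \<phi> ` (V - {z}) = {}"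
    and conf: "\<And>\<psi>. copy_Ez \<psi> F \<Longrightarrow> \<psi> ` (V - {z}) \<subseteq> f ` V"
  obtains b where "b \<in> {r, g}" "\<not> bad \<phi> F b"
proof -
  have sub: "\<phi> ` (b - {z}) \<subseteq> f ` V - e1" if b: "b \<in> {r, g}" "bad \<phi> F b" for b
  proof -
    obtain \<psi> c where \<psi>: "copy_Ez \<psi> F" "c \<in> {r, g}" "\<psi> ` (c - {z}) = \<phi> ` (b - {z})"
      using b(2) unfolding bad_def by blast
    have "\<phi> ` (b - {z}) \<subseteq> \<psi> ` (V - {z})" unfolding \<psi>(3)[symmetric] by (intro image_mono rg_minus(1) \<psi>(2))
    moreover have "\<phi> ` (b - {z}) \<subseteq> \<phi> ` (V - {z})" by (intro image_mono rg_minus(1) b(1))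
    ultimately show ?thesis using conf[OF \<psi>(1)] e1 by blast
  qed
  have "\<not> (bad \<phi> F r \<and> bad \<phi> F g)"
  proof
    assume bad: "bad \<phi> F r \<and> bad \<phi> F g"
    have un: "(r \<union> g) - {z} = (r - {z}) \<union> (g - {z})" by blast
    have "\<phi> ` ((r \<union> g) - {z}) \<subseteq> f ` V - e1"
      unfolding un image_Un using sub[of r] sub[of g] bad by simp
    then have "card (\<phi> ` ((r \<union> g) - {z})) \<le> card (f ` V - e1)"
      by (rule card_mono[rotated]) (simp add: finite_V)
    moreover have "card (\<phi> ` ((r \<union> g) - {z})) = card ((r \<union> g) - {z})"
      by (intro card_image inj_on_subset[OF \<phi>]) (use rg_minus(1)[of r] rg_minus(1)[of g] in blast)
    moreover have rgV: "r \<union> g \<subseteq> V" "z \<in> r \<union> g" "finite (r \<union> g)"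
      using edge_subset[OF rgE, of r] edge_subset[OF rgE, of g] rgz[of r] finite_V
      by (auto intro: finite_subset)
    moreover have "card ((r \<union> g) - {z}) = card (r \<union> g) - 1" using rgV by (simp add: card_Diff_singleton)
    moreover have "card (f ` V - e1) = card V - k"
    proof -
      obtain h where h: "h \<in> E" "e1 = f ` h" using f(2) by blast
      have "f ` V - e1 = f ` (V - h)" unfolding h(2) using f(1) edge_subset[OF h(1)] by (simp add: inj_on_image_set_diff)
      then have "card (f ` V - e1) = card (V - h)" using f(1) by (simp add: card_image inj_on_diff)
      also have "\<dots> = card V - k"
        using card_Diff_subset[OF finite_subset[OF edge_subset[OF h(1)] finite_V] edge_subset[OF h(1)]] edge_card[OF h(1)] by simp
      finally show ?thesis .
    qed
    moreover have "card (V - (r \<union> g)) = card V - card (r \<union> g)" using rgV by (simp add: card_Diff_subset)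
    moreover have "card (r \<union> g) \<le> card V" using rgV finite_V by (simp add: card_mono)
    moreover have "k \<le> card (r \<union> g)" using card_mono[OF rgV(3), of r] edge_card[OF rgE, of r] by simp
    ultimately show False using small by linarith
  qed
  then show ?thesis using that by blast
qed

text \<open>The graph of the first player behind his threats: the missing edge of the first threat
  either avoids \<open>z\<close> or contains it. The map \<open>f\<close> is kept throughout, since
  its copy of \<open>H\<close> contains \<open>e1\<close>.\<close>

definition attack :: "('a \<Rightarrow> nat) \<Rightarrow> nat set set \<Rightarrow> bool" where
  "attack f F \<longleftrightarrow> inj_on f V \<and>
     ((\<exists>e \<in> Ez. F = image f ` (E - {e})) \<or> (\<exists>c Z. pendant_structure f c Z F))"

text \<open>In the pendant case, degree 3 in \<open>Ez\<close> leaves two edges at each vertex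
  besides the one sent to \<open>x\<close>, too many for a pendant vertex.\<close>

lemma attack_confined:
  assumes att: "attack f F" and \<psi>: "copy_Ez \<psi> (insert x F)"
  shows "\<psi> ` (V - {z}) \<subseteq> f ` V"
proof (rule image_subsetI)
  fix u assume u: "u \<in> V - {z}"
  have inj: "inj_on \<psi> (V - {z})" and img: "\<And>y. y \<in> Ez \<Longrightarrow> \<psi> ` y \<in> insert x F"
    using \<psi> by (auto simp: copy_Ez_def)
  obtain h where h: "\<And>y. y \<in> Ez - {h} \<Longrightarrow> \<psi> ` y \<noteq> x"
    using inj_image_eq'[OF inj] by (metis Diff_iff insertCI)
  obtain a b where ab: "a \<in> Ez - {h}" "b \<in> Ez - {h}" "a \<noteq> b" "u \<in> a" "u \<in> b"
    by (rule two_edges_Ez[OF u, of h]) (rule that)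
  have F: "\<psi> ` a \<in> F" "\<psi> ` b \<in> F" using img h ab(1,2) by blast+
  have ne: "\<psi> ` a \<noteq> \<psi> ` b" using inj_image_eq'[OF inj] ab by blast
  from att consider e where "F = image f ` (E - {e})" | c Z where "pendant_structure f c Z F"
    unfolding attack_def by blast
  then show "\<psi> u \<in> f ` V"
  proof cases
    case 1
    then obtain d where d: "d \<in> E" "\<psi> ` a = f ` d" using F(1) by blast
    then show ?thesis using ab(4) edge_subset[OF d(1)] by blast
  next
    case 2
    have "\<psi> u \<in> f ` (V - {z})"
      using pendant_edge[OF 2 F(1) imageI[OF ab(4)]] pendant_edge[OF 2 F(2) imageI[OF ab(5)]] ne by metis
    then show ?thesis by blast
  qed
qed

text \<open>\<open>F\<close> and \<open>S\<close> are the graphs frozen when the forcing starts, and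
  \<open>Z\<close> collects the fresh vertices used since. The graph of the first player is known
  exactly; for the second player lower bounds suffice.\<close>

definition forcing :: "nat set set \<Rightarrow> nat set set \<Rightarrow> bool" where
  "forcing F' S' \<longleftrightarrow> (\<exists>\<phi> F S b Z. inj_on \<phi> (V - {z}) \<and> image \<phi> ` Ez \<subseteq> S' \<and> b \<in> {r, g} \<and>
     blocked F S \<and> S \<subseteq> S' \<and> \<not> bad \<phi> F b \<and> Z \<inter> \<phi> ` (V - {z}) = {} \<and> Z \<inter> \<Union>F = {} \<and>
     F' = F \<union> (\<lambda>v. insert v (\<phi> ` (b - {z}))) ` Z \<and>
     (\<lambda>v. insert v (\<phi> ` (other b - {z}))) ` Z \<subseteq> S')"

lemma forcing_start:
  assumes "inj_on \<phi> (V - {z})" "image \<phi> ` Ez \<subseteq> S" "b \<in> {r, g}" "blocked F S" "\<not> bad \<phi> F b"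
  shows "forcing F S"
  unfolding forcing_def using assms
  by (intro exI[of _ \<phi>] exI[of _ F] exI[of _ S] exI[of _ b] exI[of _ "{}"]) simp

text \<open>Vertices of \<open>Z\<close> have degree 1 in \<open>F'\<close>, so a threat not present
  in \<open>F\<close> sends \<open>z\<close> into \<open>Z\<close> and misses the other edge there.
  The rest is a copy of \<open>Ez\<close> in \<open>F\<close>, and since \<open>b\<close> is not bad
  the missing edge is one of the forcing edges.\<close>

lemma forcing_blocked:
  assumes "forcing F' S'"
  shows "blocked F' S'"
  unfolding blocked_def
proof (intro allI impI)
  fix \<psi> e assume th: "threat \<psi> e F'"
  obtain \<phi> F S b Z where inj: "inj_on \<phi> (V - {z})" and b: "b \<in> {r, g}" and bl: "blocked F S"
    and S: "S \<subseteq> S'" and nbad: "\<not> bad \<phi> F b" and Z: "Z \<inter> \<phi> ` (V - {z}) = {}" "Z \<inter> \<Union>F = {}"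
    and F': "F' = F \<union> (\<lambda>v. insert v (\<phi> ` (b - {z}))) ` Z"
    and S': "(\<lambda>v. insert v (\<phi> ` (other b - {z}))) ` Z \<subseteq> S'"
    using assms unfolding forcing_def by (elim exE conjE) (rule that)
  have \<psi>: "inj_on \<psi> V" "e \<in> E" "\<And>y. y \<in> E - {e} \<Longrightarrow> \<psi> ` y \<in> F'"
    using th by (auto simp: threat_def)
  have bV: "\<phi> ` (b - {z}) \<subseteq> \<phi> ` (V - {z})" by (intro image_mono rg_minus(1) b)
  have only: "p = insert v (\<phi> ` (b - {z}))" if p: "p \<in> F'" "v \<in> p" "v \<in> Z" for p v
  proof -
    have "p \<notin> F" using p(2,3) Z(2) by blast
    then obtain w where w: "w \<in> Z" "p = insert w (\<phi> ` (b - {z}))" using p(1) unfolding F' by blast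
    have "v = w" using p(2,3) w Z(1) bV by blast
    then show ?thesis using w by simp
  qed
  have new: "\<psi> z \<in> Z \<and> z \<in> y \<and> \<psi> ` y = insert (\<psi> z) (\<phi> ` (b - {z}))"
    if y: "y \<in> E - {e}" "\<psi> ` y \<notin> F" for y
  proof -
    obtain v where v: "v \<in> Z" "\<psi> ` y = insert v (\<phi> ` (b - {z}))" using \<psi>(3)[OF y(1)] y(2) unfolding F' by blast
    obtain u where u: "u \<in> y" "\<psi> u = v" using v(2) by (metis imageE insertI1)
    have "u = z"
    proof (rule ccontr)
      assume "u \<noteq> z"
      then have "u \<in> V - {z}" using edge_subset u(1) y(1) by blast
      then obtain a c where ac: "a \<in> E - {e, e}" "c \<in> E - {e, e}" "a \<noteq> c" "u \<in> a" "u \<in> c"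
        by (rule two_edges_E[of u e e]) (rule that)
      then have "a \<in> E - {e}" "c \<in> E - {e}" by simp_all
      then have "\<psi> ` a = \<psi> ` c"
        using only[OF \<psi>(3) imageI[OF ac(4), of \<psi>]] only[OF \<psi>(3) imageI[OF ac(5), of \<psi>]] u(2) v(1) by simp
      then show False using inj_image_eq[OF \<psi>(1)] ac(1-3) by (metis DiffD1)
    qed
    then show ?thesis using u v by simp
  qed
  show "\<psi> ` e \<in> S'"
  proof (cases "threat \<psi> e F")
    case True
    then show ?thesis using bl S unfolding blocked_def by blast
  next
    case False
    then obtain d where d: "d \<in> E - {e}" "\<psi> ` d \<notin> F" using \<psi>(1,2) unfolding threat_def by meson
    have nd: "\<psi> z \<in> Z" "z \<in> d" "\<psi> ` d = insert (\<psi> z) (\<phi> ` (b - {z}))" using new[OF d] by simp_all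
    have d_rg: "d \<in> {r, g}" using z_edge nd(2) d(1) by blast
    have o: "other d \<in> {r, g}" "other d \<noteq> d" by (rule other(1,2)[OF d_rg])+
    have e: "e = other d"
    proof (rule ccontr)
      assume "e \<noteq> other d"
      then have "other d \<in> E - {e}" using rgE[OF o(1)] by simp
      then have "\<psi> ` other d = \<psi> ` d"
        using only[OF \<psi>(3) imageI[OF rgz[OF o(1)]] nd(1)] nd(3) by simp
      then show False using inj_image_eq[OF \<psi>(1) rgE[OF o(1)] rgE[OF d_rg]] o(2) by simp
    qed
    have "\<psi> ` y \<in> F" if "y \<in> Ez" for y
      using new[of y] that e o(1) EzD(1,3)[OF that] by (auto simp: Ez_def)
    then have copy: "copy_Ez \<psi> F"
      using \<psi>(1) by (auto simp: copy_Ez_def intro: inj_on_subset)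
    have im: "\<psi> ` c = insert (\<psi> z) (\<psi> ` (c - {z}))" if "c \<in> {r, g}" for c
      using rgz[OF that] by blast
    have z_new: "\<psi> z \<notin> \<psi> ` (c - {z})" if "c \<in> {r, g}" for c
      using inj_on_image_mem_iff[OF \<psi>(1) z, of "c - {z}"] rg_minus(1)[OF that] by blast
    have "\<psi> z \<notin> \<phi> ` (b - {z})" using nd(1) Z(1) bV by blast
    then have d_eq: "\<psi> ` (d - {z}) = \<phi> ` (b - {z})"
      using nd(3) im[OF d_rg] z_new[OF d_rg] by (metis insert_ident)
    have "\<psi> ` (other d - {z}) = \<phi> ` (other b - {z})"
    proof (rule ccontr)
      assume "\<psi> ` (other d - {z}) \<noteq> \<phi> ` (other b - {z})"
      with copy d_rg d_eq have "bad \<phi> F b"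
        unfolding bad_def by (intro exI[of _ \<psi>] exI[of _ d] conjI)
      then show False using nbad by simp
    qed
    then have "\<psi> ` e = insert (\<psi> z) (\<phi> ` (other b - {z}))" using im[OF o(1)] e by simp
    then show ?thesis using S' nd(1) by blast
  qed
qed

section \<open>Types of positions with the second player to move, and the reply to each\<close>

definition position :: "nat set set \<Rightarrow> nat set set \<Rightarrow> bool" where
  "position F S \<longleftrightarrow> finite F \<and> finite S \<and> F \<subseteq> board k \<and> S \<subseteq> board k \<and> F \<inter> S = {}"

definition win_soon :: "nat set set \<Rightarrow> nat set set \<Rightarrow> bool" where
  "win_soon F S \<longleftrightarrow> \<not> has_copy V E F \<and> (\<exists>y \<in> board k - (F \<union> S). has_copy V E (insert y S))"

definition ready :: "nat set \<Rightarrow> ('a \<Rightarrow> nat) \<Rightarrow> nat set set \<Rightarrow> bool" where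
  "ready e1 \<phi> S \<longleftrightarrow> inj_on \<phi> (V - {z}) \<and> image \<phi> ` Ez \<subseteq> S \<and> e1 \<inter> \<phi> ` (V - {z}) = {}"

definition initial :: "nat set set \<Rightarrow> nat set set \<Rightarrow> bool" where
  "initial F S \<longleftrightarrow> (\<exists>e1 \<phi>. ready e1 \<phi> S \<and> e1 \<in> F \<and> card F = card E - 1)"

text \<open>The situation just after a block: \<open>F0\<close> was fully blocked, and
  \<open>x\<close> is the first player's latest edge, which may create a new threat.\<close>

definition defending :: "nat set set \<Rightarrow> nat set set \<Rightarrow> bool" where
  "defending F S \<longleftrightarrow> (\<exists>e1 \<phi> F0 x f. ready e1 \<phi> S \<and> F = insert x F0 \<and> x \<notin> F0 \<and>
     e1 \<in> image f ` E \<and> attack f F0 \<and> blocked F0 S)"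

text \<open>Owning a copy is an absorbing state: a later copy of the first player is no win for
  him.\<close>

definition drawing :: "nat set set \<Rightarrow> nat set set \<Rightarrow> bool" where
  "drawing F S \<longleftrightarrow> has_copy V E S \<or> win_soon F S \<or> forcing F S \<or> initial F S \<or> defending F S"

definition drawing_move :: "nat set set \<Rightarrow> nat set set \<Rightarrow> bool" where
  "drawing_move F S \<longleftrightarrow> (\<exists>y \<in> board k - (F \<union> S). \<forall>x \<in> board k - insert y (F \<union> S).
     drawing (insert x F) (insert y S))"

lemma position_insert:
  "position F S \<Longrightarrow> y \<in> board k - (F \<union> S) \<Longrightarrow> x \<in> board k - insert y (F \<union> S) \<Longrightarrow>
   position (insert x F) (insert y S)"
  unfolding position_def by auto

lemma has_copy_card:
  assumes "has_copy V E F" "finite F"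
  shows "card E \<le> card F"
proof -
  obtain f where f: "inj_on f V" "\<And>e. e \<in> E \<Longrightarrow> f ` e \<in> F" using assms(1) unfolding has_copy_def by blast
  have "inj_on (image f) E" using inj_image_eq[OF f(1)] by (simp add: inj_on_def)
  then show ?thesis using f(2) assms(2) by (intro card_inj_on_le[of "image f"]) auto
qed

lemma drawing_safe:
  assumes pos: "position F S" and dr: "drawing F S" and copy: "has_copy V E F"
  shows "has_copy V E S"
proof -
  have disj: "F \<inter> S = {}" "finite F" using pos by (auto simp: position_def)
  have "\<not> forcing F S" using blocked_no_copy[OF forcing_blocked disj(1)] copy by blast
  moreover have "\<not> initial F S" using has_copy_card[OF copy disj(2)] card_E by (auto simp: initial_def)
  moreover have "\<not> defending F S"
    using blocked_insert_no_copy[of _ S] disj copy by (auto simp only: defending_def)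
  ultimately show ?thesis using dr copy by (auto simp: drawing_def win_soon_def)
qed

lemma has_copy_move:
  assumes pos: "position F S" and "has_copy V E S"
  shows "drawing_move F S"
proof -
  have "infinite (board k - (F \<union> S))"
    using infinite_board[of k] k pos by (simp add: position_def Diff_infinite_finite)
  then obtain y where "y \<in> board k - (F \<union> S)" using infinite_imp_nonempty by blast
  moreover have "has_copy V E (insert y S)" for y using assms(2) by (rule has_copy_mono) blast
  ultimately show ?thesis unfolding drawing_move_def drawing_def by blast
qed

lemma win_soon_move: "win_soon F S \<Longrightarrow> drawing_move F S"
  unfolding win_soon_def drawing_move_def drawing_def by blast

lemma forcing_move:
  assumes pos: "position F' S'" and fo: "forcing F' S'"
  shows "drawing_move F' S'"
proof -
  obtain \<phi> F S b Z where inj: "inj_on \<phi> (V - {z})" and \<phi>: "image \<phi> ` Ez \<subseteq> S'" and b: "b \<in> {r, g}"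
    and bl: "blocked F S"
    and S: "S \<subseteq> S'" and nbad: "\<not> bad \<phi> F b" and Z: "Z \<inter> \<phi> ` (V - {z}) = {}" "Z \<inter> \<Union>F = {}"
    and F': "F' = F \<union> (\<lambda>v. insert v (\<phi> ` (b - {z}))) ` Z"
    and S': "(\<lambda>v. insert v (\<phi> ` (other b - {z}))) ` Z \<subseteq> S'"
    using fo unfolding forcing_def by (elim exE conjE) (rule that)
  have pos': "finite F'" "finite S'" "F' \<subseteq> board k" "S' \<subseteq> board k" "F' \<inter> S' = {}"
    using pos by (auto simp: position_def)
  have "finite e" if "e \<in> board k" for e
    using that k by (intro card_ge_0_finite) (simp add: board_def)
  then have "finite (\<Union>(F' \<union> S') \<union> \<phi> ` (V - {z}))"
    using pos' finite_V by (intro finite_UnI finite_Union) auto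
  then obtain v where v: "v \<notin> \<Union>(F' \<union> S') \<union> \<phi> ` (V - {z})"
    using ex_new_if_finite[OF infinite_UNIV_nat] by blast
  define x where "x c = insert v (\<phi> ` (c - {z}))" for c
  have bd: "x c \<in> board k" if "c \<in> {r, g}" for c
  proof -
    have "v \<notin> \<phi> ` (c - {z})" using v image_mono[OF rg_minus(1)[OF that], of \<phi>] by blast
    moreover have "card (\<phi> ` (c - {z})) = k - 1"
      using card_image[OF inj_on_subset[OF inj rg_minus(1)[OF that]]] card_rg_minus[OF that] by simp
    moreover have "finite (\<phi> ` (c - {z}))"
      using finite_subset[OF rg_minus(1)[OF that]] finite_V by simp
    ultimately show ?thesis using k by (simp add: x_def board_def)
  qed
  have fresh: "x c \<notin> F' \<union> S'" for c using v by (auto simp: x_def)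
  note o = other(1,2)[OF b]
  have ne: "x b \<noteq> x (other b)"
  proof
    assume eq: "x b = x (other b)"
    have v': "v \<notin> \<phi> ` (V - {z})" using v by blast
    have sub: "\<phi> ` (c - {z}) \<subseteq> \<phi> ` (V - {z})" if "c \<in> {r, g}" for c
      using rg_minus(1)[OF that] by (rule image_mono)
    have "\<phi> ` (b - {z}) = \<phi> ` (other b - {z})"
      by (rule insert_fresh_eq(2)[OF eq[unfolded x_def] sub[OF b] sub[OF o(1)] v' v'])
    then show False using minus_image_eq[OF inj b o(1)] o(2) by simp
  qed
  show ?thesis unfolding drawing_move_def
  proof (intro bexI[of _ "x (other b)"] ballI)
    show "x (other b) \<in> board k - (F' \<union> S')" using bd[OF o(1)] fresh by blast
    fix y assume y: "y \<in> board k - insert (x (other b)) (F' \<union> S')"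
    show "drawing (insert y F') (insert (x (other b)) S')"
    \<comment> \<open>The forced reply adds \<open>v\<close> to \<open>Z\<close>; any other reply
      lets the second player complete \<open>H\<close> with \<open>v\<close> as
      \<open>z\<close>.\<close>
    proof (cases "y = x b")
      case True
      have "F \<subseteq> F'" unfolding F' by simp
      then have vZ: "v \<notin> \<phi> ` (V - {z})" "v \<notin> \<Union>F" using v by blast+
      have "forcing (insert y F') (insert (x (other b)) S')"
        unfolding forcing_def
      proof (intro exI conjI)
        show "inj_on \<phi> (V - {z})" "b \<in> {r, g}" "blocked F S" "\<not> bad \<phi> F b" by fact+
        show "image \<phi> ` Ez \<subseteq> insert (x (other b)) S'" "S \<subseteq> insert (x (other b)) S'"
          using \<phi> S by blast+
        show "insert v Z \<inter> \<phi> ` (V - {z}) = {}" "insert v Z \<inter> \<Union>F = {}"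
          using Z vZ by simp_all
        show "insert y F' = F \<union> (\<lambda>v. insert v (\<phi> ` (b - {z}))) ` insert v Z"
          unfolding F' True x_def by simp
        show "(\<lambda>v. insert v (\<phi> ` (other b - {z}))) ` insert v Z \<subseteq> insert (x (other b)) S'"
          using S' unfolding x_def by blast
      qed
      then show ?thesis by (simp add: drawing_def)
    next
      case False
      have "\<not> has_copy V E (insert y F')"
        using y pos' by (intro blocked_insert_no_copy[OF forcing_blocked[OF fo]]) auto
      moreover have "x b \<in> board k - (insert y F' \<union> insert (x (other b)) S')"
        using bd[OF b] fresh[of b] ne False by simp
      moreover have "has_copy V E (insert (x b) (insert (x (other b)) S'))"
        unfolding has_copy_def
      proof (intro exI conjI ballI)
        show "inj_on (\<phi>(z := v)) V" using v by (intro inj_upd[OF inj]) blast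
        fix e assume "e \<in> E"
        then consider "e \<in> Ez" | "e \<in> {r, g}" using E_eq by blast
        then show "\<phi>(z := v) ` e \<in> insert (x b) (insert (x (other b)) S')"
        proof cases
          case 1
          then show ?thesis using \<phi> image_upd_Ez[OF 1, of \<phi> v] by auto
        next
          case 2
          have "e = b \<or> e = other b" using other(4)[OF b] 2 by blast
          then show ?thesis using image_upd[OF 2, of \<phi> v] by (auto simp: x_def)
        qed
      qed
      ultimately show ?thesis unfolding drawing_def win_soon_def by blast
    qed
  qed
qed

lemma initial_move:
  assumes pos: "position F S" and ini: "initial F S"
  shows "drawing_move F S"
proof (cases "blocked F S")
  case True
  obtain e1 \<phi> where \<phi>: "ready e1 \<phi> S" "e1 \<in> F" "card F = card E - 1"
    using ini unfolding initial_def by blast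
  obtain b where "b \<in> {r, g}" "\<not> bad \<phi> F b"
    by (rule not_both_bad_initial[of \<phi> F e1]) (use \<phi> pos in \<open>auto simp: ready_def position_def\<close>)
  then have "forcing F S" using \<phi>(1) True by (intro forcing_start) (auto simp: ready_def)
  then show ?thesis by (rule forcing_move[OF pos])
next
  case False
  obtain e1 \<phi> where \<phi>: "ready e1 \<phi> S" "e1 \<in> F" "card F = card E - 1"
    using ini unfolding initial_def by blast
  obtain f e where th: "threat f e F" "f ` e \<notin> S" using False unfolding blocked_def by blast
  have f: "inj_on f V" "e \<in> E" using th(1) by (auto simp: threat_def)
  have F: "F = image f ` (E - {e})" using threat_card[OF th(1)] \<phi>(3) pos by (simp add: position_def)
  have "f ` e \<notin> F" unfolding F using inj_image_eq[OF f(1)] f(2) by auto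
  then have y: "f ` e \<in> board k - (F \<union> S)" using image_in_board[OF f] th(2) by blast
  \<comment> \<open>All threats within these \<open>card E - 1\<close> edges miss the same edge, so
    one block suffices.\<close>
  have bl: "blocked F (insert (f ` e) S)"
    using unique_threat[OF f] unfolding blocked_def F by blast
  have e1: "e1 \<in> image f ` E" using \<phi>(2) unfolding F by blast
  have att: "attack f F"
  proof (cases "e \<in> Ez")
    case True
    then show ?thesis using f F unfolding attack_def by blast
  next
    case False
    then have e: "e \<in> {r, g}" using f(2) E_eq by blast
    \<comment> \<open>A threat missing an edge at \<open>z\<close> is a pendant structure with the
      single pendant vertex \<open>f z\<close>.\<close>
    have "E - {e} = Ez \<union> {other e}" using E_eq other(2,4)[OF e] rg_disj[OF e] by blast
    moreover have "insert (f z) (f ` (other e - {z})) = f ` other e"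
      using rgz[OF other(1)[OF e]] by blast
    moreover have "f z \<notin> f ` (V - {z})" using inj_on_image_mem_iff[OF f(1) z, of "V - {z}"] by blast
    ultimately have "pendant_structure f (\<lambda>_. other e) {f z} F"
      using f(1) other(1)[OF e] unfolding pendant_structure_def F by (auto intro: inj_on_subset)
    then show ?thesis using f unfolding attack_def by blast
  qed
  have "defending (insert x F) (insert (f ` e) S)" if "x \<notin> F" for x
    unfolding defending_def using that \<phi>(1) e1 att bl
    by (intro exI[of _ e1] exI[of _ \<phi>] exI[of _ F] exI[of _ x] exI[of _ f]) (auto simp: ready_def)
  then show ?thesis using y unfolding drawing_move_def drawing_def by blast
qed

lemma defending_move:
  assumes pos: "position F S" and def: "defending F S"
  shows "drawing_move F S"
proof -
  obtain e1 \<phi> F0 x f where \<phi>: "ready e1 \<phi> S" and F: "F = insert x F0" and x: "x \<notin> F0"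
      and e1: "e1 \<in> image f ` E" and att: "attack f F0" and bl: "blocked F0 S"
    using def unfolding defending_def by (elim exE conjE) (rule that)
  have f: "inj_on f V" using att by (simp add: attack_def)
  have xS: "x \<notin> S" using pos F by (auto simp: position_def)
  show ?thesis
  proof (cases "blocked F S")
    case True
    obtain b where "b \<in> {r, g}" "\<not> bad \<phi> F b"
      by (rule not_both_bad_confined[of \<phi> f e1 F])
        (use \<phi> f e1 attack_confined[OF att] in \<open>simp_all add: ready_def F\<close>)
    then have "forcing F S" using \<phi>(1) True by (intro forcing_start) (auto simp: ready_def)
    then show ?thesis by (rule forcing_move[OF pos])
  next
    case False
    \<comment> \<open>If the missing edge avoided \<open>z\<close>, \<open>no_new_threat\<close>
      would make \<open>F\<close> blocked.\<close>
    then obtain c Z where ps: "pendant_structure f c Z F0"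
      using att no_new_threat[OF f _ _ xS] bl unfolding attack_def F by blast
    have f': "inj_on f (V - {z})" using ps by (simp add: pendant_structure_def)
    obtain \<psi> e where th: "threat \<psi> e F" "\<psi> ` e \<notin> S" using False unfolding blocked_def by blast
    obtain v h where h: "h \<in> {r, g}" and v: "v \<notin> f ` (V - {z})" "v \<notin> Z"
      and x_eq: "x = insert v (f ` (h - {z}))" and y_eq: "\<psi> ` e = insert v (f ` (other h - {z}))"
      by (rule pendant_threat[OF ps bl x xS th[unfolded F]]) (rule that)
    have sub: "f ` (d - {z}) \<subseteq> f ` (V - {z})" if "d \<in> {r, g}" for d
      using rg_minus(1)[OF that] by (rule image_mono)
    note o = other(1,2)[OF h]
    have "\<psi> ` e \<noteq> x"
    proof
      assume "\<psi> ` e = x"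
      then have "f ` (other h - {z}) = f ` (h - {z})"
        unfolding x_eq y_eq by (rule insert_fresh_eq(2)[OF _ sub[OF o(1)] sub[OF h] v(1) v(1)])
      then show False using minus_image_eq[OF f' o(1) h] o(2) by simp
    qed
    moreover have "\<psi> ` e \<notin> F0" using pendant_edge[OF ps, of "\<psi> ` e" v] v y_eq by blast
    moreover have "\<psi> ` e \<in> board k" using th(1) by (auto simp: threat_def intro: image_in_board)
    ultimately have y: "\<psi> ` e \<in> board k - (F \<union> S)" using th(2) F by blast
    have bl': "blocked F (insert (\<psi> ` e) S)"
      unfolding blocked_def
    proof (intro allI impI, rule ccontr)
      fix \<psi>' e' assume th': "threat \<psi>' e' F" "\<psi>' ` e' \<notin> insert (\<psi> ` e) S"
      then have op: "\<psi>' ` e' \<notin> S" by simp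
      obtain v' h' where h': "h' \<in> {r, g}" and v': "v' \<notin> f ` (V - {z})" "v' \<notin> Z"
        and x_eq': "x = insert v' (f ` (h' - {z}))"
        and y_eq': "\<psi>' ` e' = insert v' (f ` (other h' - {z}))"
        by (rule pendant_threat[OF ps bl x xS th'(1)[unfolded F] op]) (rule that)
      \<comment> \<open>The edge \<open>x\<close> determines both its pendant vertex and its role,
        hence also the edge to block.\<close>
      have "v' = v" "f ` (h' - {z}) = f ` (h - {z})"
        using insert_fresh_eq[OF x_eq'[unfolded x_eq, symmetric] sub[OF h'] sub[OF h] v'(1) v(1)] .
      then have "h' = h" using minus_image_eq[OF f' h' h] by simp
      then show False using th'(2) y_eq y_eq' \<open>v' = v\<close> by simp
    qed
    have "pendant_structure f (c(v := h)) (insert v Z) F"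
    proof -
      have "(\<lambda>w. insert w (f ` ((c(v := h)) w - {z}))) ` insert v Z
          = insert x ((\<lambda>w. insert w (f ` (c w - {z}))) ` Z)"
      proof -
        have "(\<lambda>w. insert w (f ` ((c(v := h)) w - {z}))) ` Z = (\<lambda>w. insert w (f ` (c w - {z}))) ` Z"
          by (rule image_cong) (use v(2) in auto)
        then show ?thesis by (simp add: x_eq)
      qed
      moreover have "F0 = image f ` Ez \<union> (\<lambda>w. insert w (f ` (c w - {z}))) ` Z"
        "Z \<inter> f ` (V - {z}) = {}" "\<forall>w \<in> Z. c w \<in> {r, g}"
        using ps by (simp_all add: pendant_structure_def)
      ultimately show ?thesis
        using f' h v unfolding pendant_structure_def F by simp
    qed
    then have att': "attack f F" using f unfolding attack_def by blast
    have "defending (insert x' F) (insert (\<psi> ` e) S)" if "x' \<notin> F" for x'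
      unfolding defending_def using that \<phi>(1) e1 att' bl'
      by (intro exI[of _ e1] exI[of _ \<phi>] exI[of _ F] exI[of _ x'] exI[of _ f]) (auto simp: ready_def)
    then show ?thesis using y unfolding drawing_move_def drawing_def by blast
  qed
qed

lemma drawing_continues:
  assumes "position F S" "drawing F S"
  shows "drawing_move F S"
  using assms has_copy_move win_soon_move forcing_move initial_move defending_move
  unfolding drawing_def by blast

end

section \<open>Building the first copy\<close>

lemma map_nth_take: "i \<le> length l \<Longrightarrow> map ((!) l) [0..<i] = take i l"
  by (rule nth_equalityI) simp_all

text \<open>Makes a finite imagined game a genuine play of \<open>s\<close>. The unspecified values
  of \<open>(!) l\<close> past the end are harmless, as \<open>replay\<close> checks
  legality.\<close>

lemma hist_replay_list:
  assumes "\<And>i. i < length l \<Longrightarrow> l ! i \<in> board k - set (take i l)"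
    and "\<And>i. i < length l \<Longrightarrow> even i \<Longrightarrow> l ! i = s (take i l)"
  shows "hist s (replay k ((!) l)) (length l) = l"
proof -
  have "hist s (replay k ((!) l)) (length l) = map ((!) l) [0..<length l]"
  proof (rule hist_eq_map)
    fix i assume i: "i < length l"
    have "(!) l ` {..<i} = set (take i l)"
      using i by (simp add: nth_image[symmetric] atLeast0LessThan)
    then have "replay k ((!) l) (map ((!) l) [0..<i]) = l ! i"
      using assms(1)[OF i] by (intro replay_map) simp
    then show "l ! i = (if even i then s else replay k ((!) l)) (map ((!) l) [0..<i])"
      using assms(2)[OF i] i by (simp add: map_nth_take)
  qed
  then show ?thesis by (simp add: map_nth)
qed

abbreviation shift :: "nat \<Rightarrow> nat set \<Rightarrow> nat set" where
  "shift d \<equiv> image (\<lambda>n. n + d)"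

lemma shift_eq_iff: "shift d v = shift d w \<longleftrightarrow> v = w"
  by (simp add: inj_image_eq_iff)

lemma shift_board: "shift d w \<in> board k \<longleftrightarrow> w \<in> board k"
  by (simp add: board_def card_image)

text \<open>While the second player builds his copy, he follows the fast winning strategy \<open>s\<close> in an
  imagined game \<open>l\<close>, played on the vertices \<open>\<ge> d\<close>, i.e. off the first edge of his opponent.
  Moves of the opponent that are meaningless there are replaced by arbitrary ones.\<close>

definition building :: "nat \<Rightarrow> strategy \<Rightarrow> nat set list \<Rightarrow> nat \<Rightarrow> nat set list \<Rightarrow> bool" where
  "building k s h d l \<longleftrightarrow> (\<exists>e \<in> evens h. \<forall>n \<in> e. n < d) \<and>
     card (evens h) = Suc (length l div 2) \<and> even (length l) \<and> odds h = shift d ` evens l \<and>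
     (\<forall>i < length l. l ! i \<in> board k - set (take i l)) \<and>
     (\<forall>i < length l. even i \<longrightarrow> l ! i = s (take i l)) \<and>
     (\<forall>w \<in> board k. shift d w \<in> set h \<longrightarrow> w \<in> set l)"

lemma building_start:
  assumes "k \<ge> 1" "x \<in> board k"
  shows "building k s [x] (Suc (Max x)) []"
proof -
  have ne: "e \<noteq> {}" "finite e" if "e \<in> board k" for e
    using that assms(1) card_ge_0_finite[of e] by (auto simp: board_def)
  have "\<forall>n \<in> x. n < Suc (Max x)" using ne[OF assms(2)] by (simp add: less_Suc_eq_le)
  moreover have "shift (Suc (Max x)) w \<noteq> x" if "w \<in> board k" for w
    using ne(1)[OF that] calculation by fastforce
  ultimately show ?thesis by (auto simp: building_def)
qed

lemma building_step:
  assumes k: "k \<ge> 1" and s: "legal k s" and h: "odd (length h)" and bu: "building k s h d l"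
  obtains y where "y \<in> board k - set h"
    "\<And>x. x \<in> board k - insert y (set h) \<Longrightarrow> \<exists>a. building k s (h @ [y, x]) d (l @ [s l, a])"
proof
  have bu': "\<exists>e \<in> evens h. \<forall>n \<in> e. n < d" "card (evens h) = Suc (length l div 2)" "even (length l)"
      "odds h = shift d ` evens l"
      "\<And>i. i < length l \<Longrightarrow> l ! i \<in> board k - set (take i l)"
      "\<And>i. i < length l \<Longrightarrow> even i \<Longrightarrow> l ! i = s (take i l)"
      "\<And>w. w \<in> board k \<Longrightarrow> shift d w \<in> set h \<Longrightarrow> w \<in> set l"
    using bu by (simp_all add: building_def)
  have sl: "s l \<in> board k" "s l \<notin> set l" using s by (simp_all add: legal_def)
  \<comment> \<open>The last clause of \<open>building\<close> makes a move that is new in the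
    imagined game new in the real one.\<close>
  show y: "shift d (s l) \<in> board k - set h" using sl bu'(7) by (auto simp: shift_board)
  fix x assume x: "x \<in> board k - insert (shift d (s l)) (set h)"
  obtain a where a: "a \<in> board k - set (l @ [s l])"
    and ax: "\<And>w. x = shift d w \<Longrightarrow> w \<in> set (l @ [s l, a])"
  proof (cases "\<exists>w. x = shift d w \<and> w \<notin> set (l @ [s l])")
    case True
    then obtain w where w: "x = shift d w" "w \<notin> set (l @ [s l])" by blast
    show ?thesis
    proof (rule that[of w])
      show "w \<in> board k - set (l @ [s l])" using w x by (simp add: shift_board)
      show "v \<in> set (l @ [s l, w])" if "x = shift d v" for v
        using that w(1) shift_eq_iff[of d v w] by simp
    qed
  next
    case False
    then show ?thesis using that[OF fresh_edge[OF k]] by fastforce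
  qed
  have "building k s (h @ [shift d (s l), x]) d (l @ [s l, a])"
    unfolding building_def
  proof (intro conjI allI impI ballI)
    show "\<exists>e \<in> evens (h @ [shift d (s l), x]). \<forall>n \<in> e. n < d" using bu'(1) by auto
    show "card (evens (h @ [shift d (s l), x])) = Suc (length (l @ [s l, a]) div 2)"
      using bu'(2) h x by (simp add: set_evens_odds)
    show "even (length (l @ [s l, a]))" using bu'(3) by simp
    show "odds (h @ [shift d (s l), x]) = shift d ` evens (l @ [s l, a])"
      using bu'(3,4) h by simp
    fix i assume "i < length (l @ [s l, a])"
    then consider "i < length l" | "i = length l" | "i = Suc (length l)" by fastforce
    note cases = this
    from cases show "(l @ [s l, a]) ! i \<in> board k - set (take i (l @ [s l, a]))"
      by cases (use bu'(5) sl a in \<open>auto simp: nth_append\<close>)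
    assume "even i"
    with cases show "(l @ [s l, a]) ! i = s (take i (l @ [s l, a]))"
      by cases (use bu'(3,6) in \<open>auto simp: nth_append\<close>)
  next
    fix w assume w: "w \<in> board k" "shift d w \<in> set (h @ [shift d (s l), x])"
    then consider "shift d w \<in> set h" | "shift d w = shift d (s l)" | "x = shift d w" by fastforce
    then show "w \<in> set (l @ [s l, a])"
    proof cases
      case 1
      then show ?thesis using bu'(7) w(1) by simp
    next
      case 2
      then show ?thesis using shift_eq_iff by simp
    qed (rule ax)
  qed
  then show "\<exists>a. building k s (h @ [shift d (s l), x]) d (l @ [s l, a])" by blast
qed

context rigid_hypergraph
begin

lemma building_finish:
  assumes s: "\<And>\<tau>. legal k \<tau> \<Longrightarrow> has_copy (V - {z}) Ez (fp_edges s \<tau> (2 * card Ez))"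
    and bu: "building k s h d l" and l: "length l = 2 * card Ez"
  shows "initial (evens h) (odds h)"
proof -
  obtain e where e: "e \<in> evens h" "\<forall>n \<in> e. n < d" using bu by (auto simp: building_def)
  have "hist s (replay k ((!) l)) (2 * card Ez) = l"
    using hist_replay_list[of l k s] bu l by (simp add: building_def)
  then have "has_copy (V - {z}) Ez (evens l)"
    using s[OF legal_replay[of k "(!) l"]] k by (simp add: fp_edges_evens)
  then obtain f where f: "inj_on f (V - {z})" "\<And>x. x \<in> Ez \<Longrightarrow> f ` x \<in> evens l"
    unfolding has_copy_def by blast
  define \<phi> where "\<phi> = (\<lambda>u. f u + d)"
  have im: "\<phi> ` x = shift d (f ` x)" for x by (simp add: \<phi>_def image_image)
  have "ready e \<phi> (odds h)"
    unfolding ready_def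
  proof (intro conjI)
    show "inj_on \<phi> (V - {z})" using f(1) by (simp add: \<phi>_def inj_on_def)
    show "image \<phi> ` Ez \<subseteq> odds h" using f(2) bu im by (auto simp: building_def)
    show "e \<inter> \<phi> ` (V - {z}) = {}" using e(2) by (auto simp: \<phi>_def)
  qed
  \<comment> \<open>The first player is one edge ahead: \<open>card Ez + 1\<close> edges.\<close>
  moreover have "card (evens h) = card E - 1"
    using bu l card_Ez card_E by (simp add: building_def)
  ultimately show ?thesis using e(1) unfolding initial_def by blast
qed

lemma second_player_draws:
  assumes fast: "fast_win k (V - {z}) Ez"
  obtains \<tau> where "legal k \<tau>" "\<And>\<sigma>. legal k \<sigma> \<Longrightarrow> \<not> fp_wins V E \<sigma> \<tau>"
proof -
  have k1: "k \<ge> 1" using k by simp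
  obtain s where s: "legal k s"
      "\<And>\<tau>. legal k \<tau> \<Longrightarrow> has_copy (V - {z}) Ez (fp_edges s \<tau> (2 * card Ez))"
    using fast unfolding fast_win_def by blast
  define I where "I h \<longleftrightarrow> odd (length h) \<and> position (evens h) (odds h) \<and>
    ((\<exists>d l. length l < 2 * card Ez \<and> building k s h d l) \<or> drawing (evens h) (odds h))" for h
  have "\<exists>\<tau>. legal k \<tau> \<and> (\<forall>\<sigma>. legal k \<sigma> \<longrightarrow> \<not> fp_wins V E \<sigma> \<tau>)"
  proof (rule second_player_invariant[of k I V E])
    show "k \<ge> 1" by (rule k1)
    show "I [x]" if "x \<in> board k" for x
    proof -
      have "\<exists>d l. length l < 2 * card Ez \<and> building k s [x] d l"
        using building_start[OF k1 that] card_Ez_pos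
        by (intro exI[of _ "Suc (Max x)"] exI[of _ "[]"]) simp
      then show ?thesis using that by (simp add: I_def position_def)
    qed
    show "has_copy V E (odds h)" if "I h" and copy: "has_copy V E (evens h)" for h
    proof -
      have pos: "position (evens h) (odds h)" using that(1) by (simp add: I_def)
      \<comment> \<open>While building lasts, the first player owns at most
        \<open>card E - 2\<close> edges.\<close>
      have "card E \<le> card (evens h)" using has_copy_card[OF copy] by simp
      then have "\<not> (length l < 2 * card Ez \<and> building k s h d l)" for d l
        using card_Ez card_E by (auto simp: building_def)
      then have "drawing (evens h) (odds h)" using that(1) unfolding I_def by blast
      then show ?thesis using drawing_safe[OF pos _ copy] by blast
    qed
    show "\<exists>y \<in> board k - set h. \<forall>x \<in> board k - insert y (set h). I (h @ [y, x])" if Ih: "I h" for h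
    proof -
      have odd: "odd (length h)" and pos: "position (evens h) (odds h)" using Ih by (simp_all add: I_def)
      have "\<exists>y \<in> board k - set h. \<forall>x \<in> board k - insert y (set h).
          (\<exists>d l. length l < 2 * card Ez \<and> building k s (h @ [y, x]) d l) \<or>
          drawing (insert x (evens h)) (insert y (odds h))"
      proof (cases "drawing (evens h) (odds h)")
        case True
        then show ?thesis
          using drawing_continues[OF pos] unfolding drawing_move_def set_evens_odds by blast
      next
        case False
        then obtain d l where l: "length l < 2 * card Ez" and bu: "building k s h d l"
          using Ih unfolding I_def by blast
        obtain y where y: "y \<in> board k - set h"
          and step: "\<And>x. x \<in> board k - insert y (set h) \<Longrightarrow> \<exists>a. building k s (h @ [y, x]) d (l @ [s l, a])"
          by (rule building_step[OF k1 s(1) odd bu]) (rule that)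
        have "(\<exists>d l. length l < 2 * card Ez \<and> building k s (h @ [y, x]) d l) \<or>
            drawing (insert x (evens h)) (insert y (odds h))"
          if x: "x \<in> board k - insert y (set h)" for x
        proof -
          obtain a where a: "building k s (h @ [y, x]) d (l @ [s l, a])" using step[OF x] by blast
          have "even (length l)" using bu by (simp add: building_def)
          \<comment> \<open>Both sides are even, so the imagined game cannot skip the length at
            which the copy is due.\<close>
          then have "length l + 2 \<le> 2 * card Ez" using l by presburger
          then consider "length (l @ [s l, a]) < 2 * card Ez" | "length (l @ [s l, a]) = 2 * card Ez"
            by fastforce
          then show ?thesis
          proof cases
            case 1
            then show ?thesis using a by blast
          next
            case 2
            have "initial (evens (h @ [y, x])) (odds (h @ [y, x]))" using building_finish[OF s(2) a 2] .
            then show ?thesis using odd by (simp add: drawing_def)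
          qed
        qed
        then show ?thesis using y by blast
      qed
      then obtain y where y: "y \<in> board k - set h"
        and step: "\<And>x. x \<in> board k - insert y (set h) \<Longrightarrow>
          (\<exists>d l. length l < 2 * card Ez \<and> building k s (h @ [y, x]) d l) \<or>
          drawing (insert x (evens h)) (insert y (odds h))" by blast
      have "I (h @ [y, x])" if x: "x \<in> board k - insert y (set h)" for x
        using step[OF x] position_insert[OF pos] x y odd by (simp add: I_def set_evens_odds)
      then show ?thesis using y by blast
    qed
  qed blast
  then show ?thesis using that by blast
qed

lemma draw:
  assumes "fast_win k (V - {z}) Ez"
  shows "strong_game_draw k V E"
proof -
  obtain \<tau> where "legal k \<tau>" "\<And>\<sigma>. legal k \<sigma> \<Longrightarrow> \<not> fp_wins V E \<sigma> \<tau>"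
    by (rule second_player_draws[OF assms]) (rule that)
  moreover have "\<exists>\<sigma>. legal k \<sigma> \<and> \<not> sp_wins V E \<sigma> \<tau>" if "legal k \<tau>" for \<tau>
    using k that by (intro no_second_player_win) simp_all
  ultimately show ?thesis unfolding strong_game_draw_def by blast
qed

end

theorem theorem3p1:
  fixes k :: nat and V :: "'a set" and E :: "'a set set" and z :: 'a and r g :: "'a set"
  assumes k: "k \<ge> 2"
    and unif: "k_uniform k V E"
    and z: "z \<in> V"
    and rg: "{e \<in> E. z \<in> e} = {r, g}" "r \<noteq> g"
    and mindeg: "min_degree_ge (del_vertex_V V z) (del_vertex_E E z) 3"
    and deg4: "\<forall>u \<in> V - {z}. degree E u \<ge> 4"
    and fast: "fast_win k (del_vertex_V V z) (del_vertex_E E z)"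
    and mono: "\<forall>e\<in>E. \<forall>e'\<in>E. e \<noteq> e' \<longrightarrow>
                 (\<forall>\<phi>. monomorphism (E - {e, e'}) E \<phi> \<longrightarrow> (\<forall>a\<in>\<Union>(E - {e, e'}). \<phi> a = a))"
    and inter: "\<forall>e\<in>E. e \<inter> r \<noteq> {} \<and> e \<inter> g \<noteq> {}"
    and small: "card (V - (r \<union> g)) < k - 1"
  shows "strong_game_draw k V E"
proof -
  interpret rigid_hypergraph k V E z r g
    by unfold_locales (fact assms)+
  show ?thesis
    using fast by (intro draw) (simp add: del_vertex_V_def del_vertex_E_def Ez_def)
qed

end
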